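(* Let $G$ be a finite group with a generating set $S=\{s_1,\dots,s_k\}$, $k\ge1$. Let $\mathcal{Z}=\mathcal{Z}_i\cup\mathcal{Z}_r\cup\mathcal{Z}_b$, where $\mathcal{Z}_i$ is the set of inner face cycles, $\mathcal{Z}_r$ the set of roof edge cycles and $\mathcal{Z}_b$ the set of base edge cycles of $D_{G,S}$. Then $\mathcal{Z}$ is a cycle double cover of $D_{G,S}$ that induces a polyhedral map of $D_{G,S}$.
   Context: Notation: $[k]=\{1,\dots,k\}$. $G$ is a finite group, $S=\{s_1,\dots,s_k\}$ is a generating set with $k\ge1$ (distinct) elements in the fixed ordering $s_1<\dots<s_k$. For $d\in[k]$ put $d^+=d+1$ if $d<k$ and $k^+=1$. A cycle of an undirected graph is a connected 2-regular subgraph. A cycle double cover (CDC) is a set of cycles such that every edge lies in exactly two of them. A CDC of a cubic graph induces a polyhedral map if any two distinct cycles of it have at most one edge in common. The Cayley graph $\mathrm{Cay}_{G,S}$ is the edge-coloured directed graph with vertex set $G$ and a directed edge $(g,gs_d)$ of colour $d$ for all $g\in G$, $d\in[k]$. $d$-chain: for an edge $(g,h)$ of colour $d$ (so $h=gs_d$), $\mathfrak{C}_{[d,g,h]}$ is the graph with $2d+10$ vertices labelled $u_1,\dots,u_d,\ell_1,\dots,\ell_d,0,1,\dots,9$ (the vertex with label $v$ is written $\mathfrak{C}_{[d,g,h]}(v)$) and edges (written via labels): $\{u_i,u_{i+1}\}$ and $\{\ell_i,\ell_{i+1}\}$ for $1\le i<d$; $\{u_i,\ell_i\}$ for $1\le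 i\le d$; $\{u_d,4\}$, $\{\ell_d,7\}$; and $\{0,1\},\{0,2\},\{0,3\},\{1,3\},\{1,6\},\{2,4\},\{2,5\},\{3,5\},\{4,7\},\{5,8\},\{6,9\},\{7,8\},\{8,9\}$. Blow-up graph $A_g$ of $g\in G$: - If $k\ge3$: vertices $a_g^{d.1},a_g^{d.2},a_g^{d.3},a_g^{d.4},c_g^{d.1},c_g^{d.2}$ for $d\in[k]$; edges, for each $d\in[k]$, $\{a_g^{d.1},a_g^{d.2}\}$, $\{a_g^{d.2},c_g^{d.1}\}$, $\{c_g^{d.1},a_g^{d.3}\}$, $\{a_g^{d.3},a_g^{d.4}\}$, $\{c_g^{d.1},c_g^{d.2}\}$, $\{c_g^{d.2},c_g^{d^+.2}\}$, $\{a_g^{d.4},a_g^{d^+.1}\}$. - If $k=2$: vertices $a_g^{d.1},\dots,a_g^{d.4},c_g^{d.1}$ for $d\in\{1,2\}$; edges $\{a_g^{d.1},a_g^{d.2}\}$, $\{a_g^{d.2},c_g^{d.1}\}$, $\{c_g^{d.1},a_g^{d.3}\}$, $\{a_g^{d.3},a_g^{d.4}\}$, $\{a_g^{d.4},a_g^{d^+.1}\}$ for $d\in\{1,2\}$, and $\{c_g^{1.1},c_g^{2.1}\}$. - If $k=1$: vertices $a_g^{1.1},\dots,a_g^{1.4}$; edges $\{a_g^{1.1},a_g^{1.2}\},\{a_g^{1.2},a_g^{1.3}\},\{a_g^{1.3},a_g^{1.4}\},\{a_g^{1.4},a_g^{1.1}\}$. The graph $D_{G,S}$ is the (cubic, undirected)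 graph obtained from the disjoint union of all $A_g$, $g\in G$, and all $\mathfrak{C}_{[d,g,h]}$, one for each $d\in[k]$ and each edge $(g,h)$ of colour $d$ of $\mathrm{Cay}_{G,S}$, by adding for each such edge the four edges $\{a_g^{d.1},\mathfrak{C}_{[d,g,h]}(u_1)\}$, $\{a_g^{d.2},\mathfrak{C}_{[d,g,h]}(\ell_1)\}$, $\{\mathfrak{C}_{[d,g,h]}(6),a_h^{d.4}\}$, $\{\mathfrak{C}_{[d,g,h]}(9),a_h^{d.3}\}$. Inner face cycles $\mathcal{Z}_i$ (each cycle is given by its cyclic vertex sequence): for every edge $(g,h)$ of colour $d$, with labels referring to $\mathfrak{C}_{[d,g,h]}$: $(u_i,u_{i+1},\ell_{i+1},\ell_i)$ for $1\le i<d$; $(u_d,4,7,\ell_d)$; $(0,1,3)$; $(0,2,5,3)$; $(2,4,7,8,5)$; $(1,3,5,8,9,6)$; $(a_g^{d.1},a_g^{d.2},\ell_1,u_1)$; $(6,9,a_h^{d.3},a_h^{d.4})$. Moreover for every $g\in G$: if $k\ge3$, the cycles $(c_g^{d.1},a_g^{d.3},a_g^{d.4},a_g^{d^+.1},a_g^{d^+.2},c_g^{d^+.1},c_g^{d^+.2},c_g^{d.2})$ for $d\in[k]$ and $(c_g^{1.2},c_g^{2.2},\dots,c_g^{k.2})$; if $k=2$, the cycles $(c_g^{d.1},a_g^{d.3},a_g^{d.4},a_g^{d^+.1},a_g^{d^+.2},c_g^{d^+.1})$ for $d\in\{1,2\}$; if $k=1$, the cycle $(a_g^{1.1},a_g^{1.2},a_g^{1.3},a_g^{1.4})$.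 For an edge $(g,h)$ of colour $d$, the upper path from $a_g^{d.1}$ to $a_h^{d.4}$ is $a_g^{d.1},u_1,\dots,u_d,4,2,0,1,6,a_h^{d.4}$, and the lower path from $a_g^{d.2}$ to $a_h^{d.3}$ is $a_g^{d.2},\ell_1,\dots,\ell_d,7,8,9,a_h^{d.3}$ (labels in $\mathfrak{C}_{[d,g,h]}$). Roof edge cycles $\mathcal{Z}_r$: the roof edge cycle with starting point $g$ is traced as follows. Start at $a_g^{1.1}$ and take the upper path to $A_{gs_1}$; in general, having entered $A_h$ through the generator $s_d$ (i.e. at $a_h^{d.4}$), traverse the edge $\{a_h^{d.4},a_h^{d^+.1}\}$ and take the upper path from $a_h^{d^+.1}$ to $A_{hs_{d^+}}$; continue until a vertex is encountered for the second time. Let $H_{\mathrm{vis}}$ be the set of all $h\in G$ such that $A_h$ is entered via the last generator $s_k$. The set $\mathcal{Z}_r$ is obtained by setting $\tilde G:=G$, computing the roof edge cycle with starting point $1_G$, removing its set $H_{\mathrm{vis}}$ from $\tilde G$, and then repeating with any remaining element of $\tilde G$ as starting point until $\tilde G$ is empty; $\mathcal{Z}_r$ consists of all cycles computed. Base edge cycles $\mathcal{Z}_b$: for $d\in[k]$, the base edge cycle with starting point $g$ and generator $s_d$ starts at $a_g^{d.2}$ and takes the lower path to $a_{gs_d}^{d.3}$; in general, having arrived at $a_h^{d.3}$ it goes on to $c_h^{d.1}$, then $a_h^{d.2}$ (if $k=1$, directly from $a_h^{1.3}$ to $a_h^{1.2}$), and then takes the lower path to $a_{hs_d}^{d.3}$;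 continue until a vertex is encountered for the second time. Let $\bar H_{\mathrm{vis}}$ be the set of group elements $h$ visited. For each $d\in[k]$ set $\tilde G_d:=G$ and, as long as $\tilde G_d\neq\emptyset$, choose $g\in\tilde G_d$, compute the base edge cycle with starting point $g$ and generator $s_d$, and remove $\bar H_{\mathrm{vis}}$ from $\tilde G_d$; $\mathcal{Z}_b$ consists of all cycles computed for all $d\in[k]$. *)

theory Defs
  imports "HOL-Algebra.Generated_Groups" "HOL-Library.While_Combinator"
begin

section \<open>Finite undirected graphs and cycle double covers\<close>

record 'v ugraph =
  verts :: "'v set"
  edges :: "'v set set"

definition fin_ugraph :: "'v ugraph \<Rightarrow> bool" where
  "fin_ugraph H \<longleftrightarrow> finite (verts H) \<and> (\<forall>e\<in>edges H. e \<subseteq> verts H \<and> card e = 2)"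

definition subgraph :: "'v ugraph \<Rightarrow> 'v ugraph \<Rightarrow> bool" where
  "subgraph H' H \<longleftrightarrow> fin_ugraph H' \<and> verts H' \<subseteq> verts H \<and> edges H' \<subseteq> edges H"

definition degree :: "'v ugraph \<Rightarrow> 'v \<Rightarrow> nat" where
  "degree H v = card {e \<in> edges H. v \<in> e}"

definition regular :: "nat \<Rightarrow> 'v ugraph \<Rightarrow> bool" where
  "regular r H \<longleftrightarrow> (\<forall>v\<in>verts H. degree H v = r)"

definition connected :: "'v ugraph \<Rightarrow> bool" where
  "connected H \<longleftrightarrow> verts H \<noteq> {} \<and>
     (\<forall>u\<in>verts H. \<forall>v\<in>verts H. (u, v) \<in> {(x, y). {x, y} \<in> edges H}\<^sup>*)"

definition cubic_graph :: "'v ugraph \<Rightarrow> bool" where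
  "cubic_graph H \<longleftrightarrow> fin_ugraph H \<and> regular 3 H"

definition cycle_in :: "'v ugraph \<Rightarrow> 'v ugraph \<Rightarrow> bool" where
  "cycle_in H Z \<longleftrightarrow> subgraph Z H \<and> connected Z \<and> regular 2 Z"

definition cycle_double_cover :: "'v ugraph \<Rightarrow> 'v ugraph set \<Rightarrow> bool" where
  "cycle_double_cover H \<Z> \<longleftrightarrow>
     (\<forall>Z\<in>\<Z>. cycle_in H Z) \<and> (\<forall>e\<in>edges H. card {Z\<in>\<Z>. e \<in> edges Z} = 2)"

text \<open>The notion is only meaningful for a cycle double cover of a cubic graph, so both
  requirements are part of the definition.\<close>

definition induces_polyhedral_map :: "'v ugraph \<Rightarrow> 'v ugraph set \<Rightarrow> bool" where
  "induces_polyhedral_map H \<Z> \<longleftrightarrow>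
     cubic_graph H \<and> cycle_double_cover H \<Z> \<and>
     (\<forall>Z\<in>\<Z>. \<forall>Z'\<in>\<Z>. Z \<noteq> Z' \<longrightarrow> card (edges Z \<inter> edges Z') \<le> 1)"

definition cyc :: "'v list \<Rightarrow> 'v ugraph" where
  "cyc xs = \<lparr>verts = set xs,
     edges = {{xs ! i, xs ! (Suc i mod length xs)} | i. i < length xs}\<rparr>"


section \<open>The Cayley graph and the graph \<open>D\<close>\<close>

text \<open>The ordered generating set \<open>s\<^sub>1 < \<dots> < s\<^sub>k\<close> is given by
  \<open>s :: nat \<Rightarrow> 'a\<close>, of which only the values at \<open>1, \<dots>, k\<close> matter. A triple \<open>(d, g, h)\<close> is the
  edge \<open>(g, h)\<close> of colour \<open>d\<close>; \<open>1\<^sub>G\<close> may be a generator, in which case it yields loops.\<close>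

definition cayley_edges :: "('a, 'b) monoid_scheme \<Rightarrow> nat \<Rightarrow> (nat \<Rightarrow> 'a) \<Rightarrow> (nat \<times> 'a \<times> 'a) set" where
  "cayley_edges G k s = {(d, g, g \<otimes>\<^bsub>G\<^esub> s d) | d g. d \<in> {1..k} \<and> g \<in> carrier G}"

definition nxt :: "nat \<Rightarrow> nat \<Rightarrow> nat" where
  "nxt k d = (if d < k then d + 1 else 1)"

text \<open>Chain labels: \<open>Up i\<close> is \<open>u\<^sub>i\<close>, \<open>Low i\<close> is \<open>\<ell>\<^sub>i\<close>, and \<open>Num n\<close> is the label \<open>n\<close>.
  Vertices: \<open>AV g d i\<close> is the vertex \<open>a\<close> with subscript \<open>g\<close> and superscript \<open>d.i\<close>, \<open>CV g d i\<close>
  likewise for \<open>c\<close>, and \<open>Ch d g h l\<close> is the vertex labelled \<open>l\<close> of the \<open>d\<close>-chain of \<open>(g, h)\<close>.\<close>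

datatype label = Up nat | Low nat | Num nat

datatype 'a vertex = AV 'a nat nat | CV 'a nat nat | Ch nat 'a 'a label

definition chain_labels :: "nat \<Rightarrow> label set" where
  "chain_labels d = Up ` {1..d} \<union> Low ` {1..d} \<union> Num ` {0..9}"

definition chain_label_edges :: "nat \<Rightarrow> label set set" where
  "chain_label_edges d =
     {{Up i, Up (i+1)} | i. 1 \<le> i \<and> i < d} \<union>
     {{Low i, Low (i+1)} | i. 1 \<le> i \<and> i < d} \<union>
     {{Up i, Low i} | i. 1 \<le> i \<and> i \<le> d} \<union>
     {{Up d, Num 4}, {Low d, Num 7}} \<union>
     {{Num 0, Num 1}, {Num 0, Num 2}, {Num 0, Num 3}, {Num 1, Num 3}, {Num 1, Num 6},
      {Num 2, Num 4}, {Num 2, Num 5}, {Num 3, Num 5}, {Num 4, Num 7}, {Num 5, Num 8},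
      {Num 6, Num 9}, {Num 7, Num 8}, {Num 8, Num 9}}"

definition chain :: "nat \<Rightarrow> 'a \<Rightarrow> 'a \<Rightarrow> 'a vertex ugraph" where
  "chain d g h = \<lparr>verts = Ch d g h ` chain_labels d,
     edges = (\<lambda>e. Ch d g h ` e) ` chain_label_edges d\<rparr>"

definition blowup :: "nat \<Rightarrow> 'a \<Rightarrow> 'a vertex ugraph" where
  "blowup k g =
    (if k \<ge> 3 then
       \<lparr>verts = (\<Union>d\<in>{1..k}. {AV g d 1, AV g d 2, AV g d 3, AV g d 4, CV g d 1, CV g d 2}),
        edges = (\<Union>d\<in>{1..k}. {{AV g d 1, AV g d 2}, {AV g d 2, CV g d 1}, {CV g d 1, AV g d 3},
                  {AV g d 3, AV g d 4}, {CV g d 1, CV g d 2}, {CV g d 2, CV g (nxt k d) 2},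
                  {AV g d 4, AV g (nxt k d) 1}})\<rparr>
     else if k = 2 then
       \<lparr>verts = (\<Union>d\<in>{1,2}. {AV g d 1, AV g d 2, AV g d 3, AV g d 4, CV g d 1}),
        edges = (\<Union>d\<in>{1,2}. {{AV g d 1, AV g d 2}, {AV g d 2, CV g d 1}, {CV g d 1, AV g d 3},
                  {AV g d 3, AV g d 4}, {AV g d 4, AV g (nxt k d) 1}})
                \<union> {{CV g 1 1, CV g 2 1}}\<rparr>
     else
       \<lparr>verts = {AV g 1 1, AV g 1 2, AV g 1 3, AV g 1 4},
        edges = {{AV g 1 1, AV g 1 2}, {AV g 1 2, AV g 1 3}, {AV g 1 3, AV g 1 4},
                 {AV g 1 4, AV g 1 1}}\<rparr>)"

definition link_edges :: "nat \<Rightarrow> 'a \<Rightarrow> 'a \<Rightarrow> 'a vertex set set" where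
  "link_edges d g h =
     {{AV g d 1, Ch d g h (Up 1)}, {AV g d 2, Ch d g h (Low 1)},
      {Ch d g h (Num 6), AV h d 4}, {Ch d g h (Num 9), AV h d 3}}"

definition D_graph :: "('a, 'b) monoid_scheme \<Rightarrow> nat \<Rightarrow> (nat \<Rightarrow> 'a) \<Rightarrow> 'a vertex ugraph" where
  "D_graph G k s =
     \<lparr>verts = (\<Union>g\<in>carrier G. verts (blowup k g)) \<union>
              (\<Union>(d, g, h)\<in>cayley_edges G k s. verts (chain d g h)),
      edges = (\<Union>g\<in>carrier G. edges (blowup k g)) \<union>
              (\<Union>(d, g, h)\<in>cayley_edges G k s. edges (chain d g h) \<union> link_edges d g h)\<rparr>"


section \<open>Inner face cycles\<close>

definition chain_faces :: "nat \<Rightarrow> 'a \<Rightarrow> 'a \<Rightarrow> 'a vertex ugraph set" where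
  "chain_faces d g h = (let c = Ch d g h; n = (\<lambda>i. c (Num i)) in
     {cyc [c (Up i), c (Up (i+1)), c (Low (i+1)), c (Low i)] | i. 1 \<le> i \<and> i < d} \<union>
     {cyc [c (Up d), n 4, n 7, c (Low d)],
      cyc [n 0, n 1, n 3],
      cyc [n 0, n 2, n 5, n 3],
      cyc [n 2, n 4, n 7, n 8, n 5],
      cyc [n 1, n 3, n 5, n 8, n 9, n 6],
      cyc [AV g d 1, AV g d 2, c (Low 1), c (Up 1)],
      cyc [n 6, n 9, AV h d 3, AV h d 4]})"

definition blowup_faces :: "nat \<Rightarrow> 'a \<Rightarrow> 'a vertex ugraph set" where
  "blowup_faces k g =
    (if k \<ge> 3 then
       {cyc [CV g d 1, AV g d 3, AV g d 4, AV g (nxt k d) 1, AV g (nxt k d) 2,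
             CV g (nxt k d) 1, CV g (nxt k d) 2, CV g d 2] | d. d \<in> {1..k}} \<union>
       {cyc (map (\<lambda>d. CV g d 2) [1..<k+1])}
     else if k = 2 then
       {cyc [CV g d 1, AV g d 3, AV g d 4, AV g (nxt k d) 1, AV g (nxt k d) 2,
             CV g (nxt k d) 1] | d. d \<in> {1,2}}
     else {cyc [AV g 1 1, AV g 1 2, AV g 1 3, AV g 1 4]})"

definition inner_faces :: "('a, 'b) monoid_scheme \<Rightarrow> nat \<Rightarrow> (nat \<Rightarrow> 'a) \<Rightarrow> 'a vertex ugraph set" where
  "inner_faces G k s =
     (\<Union>(d, g, h)\<in>cayley_edges G k s. chain_faces d g h) \<union> (\<Union>g\<in>carrier G. blowup_faces k g)"


section \<open>Tracing cycles\<close>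

definition upper_path :: "nat \<Rightarrow> 'a \<Rightarrow> 'a \<Rightarrow> 'a vertex list" where
  "upper_path d g h =
     [AV g d 1] @ map (\<lambda>i. Ch d g h (Up i)) [1..<d+1] @
     map (\<lambda>n. Ch d g h (Num n)) [4, 2, 0, 1, 6] @ [AV h d 4]"

definition lower_path :: "nat \<Rightarrow> 'a \<Rightarrow> 'a \<Rightarrow> 'a vertex list" where
  "lower_path d g h =
     [AV g d 2] @ map (\<lambda>i. Ch d g h (Low i)) [1..<d+1] @
     map (\<lambda>n. Ch d g h (Num n)) [7, 8, 9] @ [AV h d 3]"

text \<open>The infinite walk obtained by concatenating nonempty blocks \<open>b 0, b 1, \<dots>\<close>; the first
  \<open>n + 1\<close> blocks together have more than \<open>n\<close> vertices.\<close>

definition walk :: "(nat \<Rightarrow> 'v list) \<Rightarrow> nat \<Rightarrow> 'v" where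
  "walk b n = concat (map b [0..<n+1]) ! n"

definition stop_time :: "(nat \<Rightarrow> 'v) \<Rightarrow> nat" where
  "stop_time w = (LEAST n. w n \<in> w ` {..<n})"

text \<open>All vertices and edges traversed until a vertex is encountered for the second time.\<close>

definition traced :: "(nat \<Rightarrow> 'v) \<Rightarrow> 'v ugraph" where
  "traced w = \<lparr>verts = w ` {..stop_time w},
     edges = {{w i, w (Suc i)} | i. i < stop_time w}\<rparr>"

text \<open>Pairs \<open>(h, d)\<close>: the roof walk leaves the blow-up of \<open>h\<close> through the generator \<open>s\<^sub>d\<close>.\<close>

definition roof_state ::
  "('a, 'b) monoid_scheme \<Rightarrow> nat \<Rightarrow> (nat \<Rightarrow> 'a) \<Rightarrow> 'a \<Rightarrow> nat \<Rightarrow> 'a \<times> nat" where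
  "roof_state G k s g n = ((\<lambda>(h, d). (h \<otimes>\<^bsub>G\<^esub> s d, nxt k d)) ^^ n) (g, 1)"

definition roof_cycle ::
  "('a, 'b) monoid_scheme \<Rightarrow> nat \<Rightarrow> (nat \<Rightarrow> 'a) \<Rightarrow> 'a \<Rightarrow> 'a vertex ugraph" where
  "roof_cycle G k s g =
     traced (walk (\<lambda>n. case roof_state G k s g n of (h, d) \<Rightarrow> upper_path d h (h \<otimes>\<^bsub>G\<^esub> s d)))"

text \<open>A roof walk enters the blow-up of \<open>h\<close> via \<open>s\<^sub>k\<close> exactly at the vertex \<open>AV h k 4\<close>.\<close>

definition roof_visited ::
  "('a, 'b) monoid_scheme \<Rightarrow> nat \<Rightarrow> (nat \<Rightarrow> 'a) \<Rightarrow> 'a \<Rightarrow> 'a set" where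
  "roof_visited G k s g = {h \<in> carrier G. AV h k 4 \<in> verts (roof_cycle G k s g)}"

definition base_elem ::
  "('a, 'b) monoid_scheme \<Rightarrow> (nat \<Rightarrow> 'a) \<Rightarrow> nat \<Rightarrow> 'a \<Rightarrow> nat \<Rightarrow> 'a" where
  "base_elem G s d g n = ((\<lambda>h. h \<otimes>\<^bsub>G\<^esub> s d) ^^ n) g"

definition base_cycle ::
  "('a, 'b) monoid_scheme \<Rightarrow> nat \<Rightarrow> (nat \<Rightarrow> 'a) \<Rightarrow> nat \<Rightarrow> 'a \<Rightarrow> 'a vertex ugraph" where
  "base_cycle G k s d g =
     traced (walk (\<lambda>n. let h = base_elem G s d g n; h' = h \<otimes>\<^bsub>G\<^esub> s d in
       lower_path d h h' @ (if k = 1 then [] else [CV h' d 1])))"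

definition base_visited ::
  "('a, 'b) monoid_scheme \<Rightarrow> nat \<Rightarrow> (nat \<Rightarrow> 'a) \<Rightarrow> nat \<Rightarrow> 'a \<Rightarrow> 'a set" where
  "base_visited G k s d g =
     {h \<in> carrier G. verts (blowup k h) \<inter> verts (base_cycle G k s d g) \<noteq> {}}"

text \<open>The procedure: while the set \<open>T\<close> of remaining elements is nonempty, pick \<open>ch T \<in> T\<close>, add its
  cycle and remove the elements it visits. Since \<open>T\<close> never takes the same value twice, every
  sequence of picks comes from some selector \<open>ch\<close>.\<close>

definition sweep :: "('a set \<Rightarrow> 'a) \<Rightarrow> ('a \<Rightarrow> 'c) \<Rightarrow> ('a \<Rightarrow> 'a set) \<Rightarrow> 'a set \<Rightarrow> 'c set" where
  "sweep ch cy vis T =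
     snd (while (\<lambda>(T, Z). T \<noteq> {})
                (\<lambda>(T, Z). (T - vis (ch T), insert (cy (ch T)) Z))
                (T, {}))"

definition selector :: "'a set \<Rightarrow> ('a set \<Rightarrow> 'a) \<Rightarrow> bool" where
  "selector X ch \<longleftrightarrow> (\<forall>T. T \<subseteq> X \<and> T \<noteq> {} \<longrightarrow> ch T \<in> T)"

definition roof_cycles ::
  "('a, 'b) monoid_scheme \<Rightarrow> nat \<Rightarrow> (nat \<Rightarrow> 'a) \<Rightarrow> ('a set \<Rightarrow> 'a) \<Rightarrow> 'a vertex ugraph set" where
  "roof_cycles G k s ch =
     insert (roof_cycle G k s \<one>\<^bsub>G\<^esub>)
       (sweep ch (roof_cycle G k s) (roof_visited G k s) (carrier G - roof_visited G k s \<one>\<^bsub>G\<^esub>))"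

definition base_cycles ::
  "('a, 'b) monoid_scheme \<Rightarrow> nat \<Rightarrow> (nat \<Rightarrow> 'a) \<Rightarrow> (nat \<Rightarrow> 'a set \<Rightarrow> 'a) \<Rightarrow> 'a vertex ugraph set" where
  "base_cycles G k s ch =
     (\<Union>d\<in>{1..k}. sweep (ch d) (base_cycle G k s d) (base_visited G k s d) (carrier G))"

end

theory Submission
  imports Defs
begin

text \<open>Every edge of \<open>D\<close> lies on exactly two faces, so a cycle double cover is encoded by the map
  \<open>sides\<close> sending an edge to its pair of faces. Two faces share at most one edge precisely when this
  map is injective, and it can be written down explicitly: a roof (base) cycle is determined by an
  orbit of the permutation \<open>(g, d) \<mapsto> (g s\<^sub>d, d\<^sup>+)\<close> (respectively \<open>(g, d) \<mapsto> (g s\<^sub>d, d)\<close>), so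
  injectivity is a finite case distinction over the types of edges. As a traced cycle depends
  only on the orbit of its starting point, the choices made by the procedures are irrelevant.\<close>

section \<open>Cycles given by vertex lists\<close>

text \<open>The roof and base cycles can be long and their lengths are unknown, so faces are never
  compared as vertex lists. What saves the argument is that no edge lies between two of these global
  faces: every edge has a bounded face on at least one side, and the name of that face leaves only a
  few candidates for the edge. Orbits really matter in one place, where an octagon meets a base
  cycle in \<open>ECA\<close> or \<open>EAC\<close>. These two edges of \<open>Oct h d\<close> have
  the neighbouring colours \<open>d\<close> and \<open>nxt k d\<close>, whereas a base cycle keeps
  its colour, so they lie on different base cycles unless \<open>k = 1\<close>, where the blow-up
  has the single edge \<open>EAC\<close> in their place. Similarly, two octagons would share two
  edges \<open>EC12\<close> if each of their colours preceded the other; this excludes itself for k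
  \<ge> 3, and for \<open>k = 2\<close> the two edges are one. Faces are introduced backwards, as
  the edge sets that the side map assigns to a name; the remaining work is to recognise the listed
  and the traced cycles among them.\<close>

fun path_edges :: "'v list \<Rightarrow> 'v set set" where
  "path_edges [] = {}"
| "path_edges [x] = {}"
| "path_edges (x # y # xs) = insert {x, y} (path_edges (y # xs))"

lemma path_edges_conv_nth: "path_edges xs = {{xs ! i, xs ! Suc i} | i. Suc i < length xs}"
proof (induction xs rule: path_edges.induct)
  case (3 x y xs)
  have "{{(x # y # xs) ! i, (x # y # xs) ! Suc i} | i. Suc i < length (x # y # xs)}
      = insert {x, y} {{(y # xs) ! i, (y # xs) ! Suc i} | i. Suc i < length (y # xs)}" (is "?A = insert _ ?B")
  proof
    show "?A \<subseteq> insert {x, y} ?B"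
    proof
      fix e assume "e \<in> ?A"
      then obtain i where i: "e = {(x # y # xs) ! i, (x # y # xs) ! Suc i}" "Suc i < length (x # y # xs)"
        by blast
      then show "e \<in> insert {x, y} ?B" by (cases i) auto
    qed
    show "insert {x, y} ?B \<subseteq> ?A"
    proof
      fix e assume "e \<in> insert {x, y} ?B"
      then consider "e = {x, y}"
        | i where "e = {(y # xs) ! i, (y # xs) ! Suc i}" "Suc i < length (y # xs)" by blast
      then show "e \<in> ?A"
      proof cases
        case 1
        then show ?thesis by (intro CollectI exI[of _ 0]) simp
      next
        case (2 i)
        then show ?thesis by (intro CollectI exI[of _ "Suc i"]) simp
      qed
    qed
  qed
  then show ?case using 3 by simp
qed auto

lemma path_edges_append:
  "xs \<noteq> [] \<Longrightarrow> ys \<noteq> [] \<Longrightarrow>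
    path_edges (xs @ ys) = path_edges xs \<union> path_edges ys \<union> {{last xs, hd ys}}"
  by (induction xs rule: path_edges.induct) (cases ys, auto)+

lemma path_edges_map_upt:
  "path_edges (map f [m..<Suc n]) = (\<lambda>i. {f i, f (Suc i)}) ` {m..<n}"
proof (induction n)
  case (Suc n)
  show ?case
  proof (cases "m \<le> n")
    case True
    then have "path_edges (map f [m..<Suc n] @ [f (Suc n)])
        = insert {f n, f (Suc n)} (path_edges (map f [m..<Suc n]))"
      by (subst path_edges_append) auto
    then show ?thesis using True Suc by (simp add: atLeastLessThanSuc)
  qed auto
qed auto

text \<open>Keeping \<open>hd ys\<close> at the end of the left part retains the joining edge, so
  the induction over blocks needs no separate case for an empty left part.\<close>

lemma path_edges_join:
  "ys \<noteq> [] \<Longrightarrow> path_edges (xs @ ys @ [z])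
    = path_edges (xs @ [hd ys]) \<union> path_edges ys \<union> {{last ys, z}}"
proof (cases "xs = []")
  case False
  moreover assume "ys \<noteq> []"
  ultimately show ?thesis
    by (subst path_edges_append, simp_all, subst (1 2) path_edges_append) auto
qed (simp add: path_edges_append)

text \<open>The extra final vertex is the head of the next block; if the blocks repeat after
  \<open>p\<close> steps, it is the starting vertex and the list is a closed walk.\<close>

lemma path_edges_concat:
  assumes "\<And>n. n \<le> p \<Longrightarrow> b n \<noteq> []"
  shows "path_edges (concat (map b [0..<p]) @ [hd (b p)])
    = (\<Union>n<p. path_edges (b n) \<union> {{last (b n), hd (b (Suc n))}})"
  using assms
proof (induction p)
  case (Suc p)
  have ne: "b p \<noteq> []" "b (Suc p) \<noteq> []" using Suc.prems by auto
  have IH: "path_edges (concat (map b [0..<p]) @ [hd (b p)])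
    = (\<Union>n<p. path_edges (b n) \<union> {{last (b n), hd (b (Suc n))}})" using Suc by simp
  let ?c = "concat (map b [0..<p])"
  have "path_edges (?c @ b p @ [hd (b (Suc p))])
      = path_edges (?c @ [hd (b p)]) \<union> path_edges (b p) \<union> {{last (b p), hd (b (Suc p))}}"
    by (rule path_edges_join[OF ne(1)])
  then show ?case using IH by (simp add: lessThan_Suc) blast
qed simp

text \<open>Closing the list with its own head trades index arithmetic modulo the length for an open
  path, which splits along concatenation.\<close>

lemma edges_cyc: "xs \<noteq> [] \<Longrightarrow> edges (cyc xs) = path_edges (xs @ [hd xs])"
  unfolding path_edges_conv_nth cyc_def ugraph.simps
  by (rule Collect_cong, rule ex_cong1) (auto simp: nth_append mod_Suc hd_conv_nth)

text \<open>With at least three positions the two neighbours of a position differ, so its two edges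
  differ and the degree is 2. The vertices lie in \<open>H\<close> because each of them is on an
  edge of the cycle.\<close>

lemma cycle_in_cyc:
  assumes H: "fin_ugraph H" and xs: "distinct xs" "length xs \<ge> 3"
    and sub: "edges (cyc xs) \<subseteq> edges H"
  shows "cycle_in H (cyc xs)"
proof -
  define n where "n = length xs"
  define nx where "nx i = Suc i mod n" for i
  define ed where "ed i = {xs ! i, xs ! nx i}" for i
  have n: "n \<ge> 3" using xs n_def by simp
  have E: "edges (cyc xs) = ed ` {..<n}" unfolding cyc_def ed_def nx_def n_def by auto
  have V: "verts (cyc xs) = (\<lambda>i. xs ! i) ` {..<n}" unfolding cyc_def n_def
    by (auto simp: set_conv_nth)
  have nx: "nx i < n" for i using n nx_def by simp
  have inj: "xs ! i = xs ! j \<longleftrightarrow> i = j" if "i < n" "j < n" for i j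
    using that xs(1) n_def nth_eq_iff_index_eq by blast
  have nx_neq: "nx i \<noteq> i" "nx (nx i) \<noteq> i" if "i < n" for i
  proof -
    show "nx i \<noteq> i" using that n unfolding nx_def by (cases "Suc i = n") auto
    show "nx (nx i) \<noteq> i" using that n unfolding nx_def
      by (cases "Suc i = n"; cases "Suc (Suc i) = n") auto
  qed
  have subg: "subgraph (cyc xs) H"
  proof -
    have "e \<subseteq> verts (cyc xs) \<and> card e = 2" if e: "e \<in> edges (cyc xs)" for e
    proof -
      obtain i where i: "i < n" "e = ed i" using e unfolding E by blast
      then have "xs ! i \<noteq> xs ! nx i" using nx_neq(1)[OF i(1)] inj[OF i(1) nx[of i]] by simp
      then have "card (ed i) = 2" unfolding ed_def by simp
      moreover have "ed i \<subseteq> verts (cyc xs)" using i(1) nx[of i] unfolding V ed_def by simp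
      ultimately show ?thesis using i(2) by simp
    qed
    moreover have "verts (cyc xs) \<subseteq> verts H"
    proof
      fix v assume "v \<in> verts (cyc xs)"
      then obtain e where "e \<in> edges (cyc xs)" "v \<in> e" unfolding E V ed_def by blast
      then show "v \<in> verts H" using sub H unfolding fin_ugraph_def by blast
    qed
    ultimately show ?thesis using sub unfolding subgraph_def fin_ugraph_def
      by (auto simp: V)
  qed
  have conn: "connected (cyc xs)"
  proof -
    let ?R = "{(x, y). {x, y} \<in> edges (cyc xs)}"
    have sym: "sym (?R\<^sup>*)" by (rule sym_rtrancl, rule symI, simp, subst insert_commute, assumption)
    have st: "(xs ! 0, xs ! i) \<in> ?R\<^sup>*" if "i < n" for i
      using that
    proof (induction i)
      case (Suc i)
      then have "{xs ! i, xs ! Suc i} = ed i" by (simp add: ed_def nx_def)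
      then have "(xs ! i, xs ! Suc i) \<in> ?R" using Suc.prems by (auto simp: E)
      then show ?case using Suc by (meson Suc_lessD rtrancl.rtrancl_into_rtrancl)
    qed simp
    have "(xs ! i, xs ! j) \<in> ?R\<^sup>*" if "i < n" "j < n" for i j
      using st[OF that(1)] st[OF that(2)] sym by (meson rtrancl_trans symD)
    then show ?thesis unfolding connected_def V using n by (auto simp: lessThan_empty_iff bot_nat_def)
  qed
  have "degree (cyc xs) (xs ! j) = 2" if j: "j < n" for j
  proof -
    \<comment> \<open>The cyclic predecessor of \<open>j\<close>: the edges at \<open>xs ! j\<close>
      are the ones starting at positions \<open>j\<close> and \<open>pj\<close>.\<close>
    define pj where "pj = (if j = 0 then n - 1 else j - 1)"
    have pj: "pj < n" "nx pj = j" using j n unfolding pj_def nx_def by auto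
    have iff: "nx i = j \<longleftrightarrow> i = pj" if "i < n" for i
      using that j n unfolding pj_def nx_def by (cases "Suc i = n") auto
    have "xs ! j \<in> ed i \<longleftrightarrow> i = j \<or> i = pj" if "i < n" for i
      using inj[OF j that] inj[OF j nx[of i]] iff[OF that] unfolding ed_def by auto
    then have "{e \<in> edges (cyc xs). xs ! j \<in> e} = {ed j, ed pj}"
      using j pj(1) unfolding E by blast
    moreover have "ed j \<noteq> ed pj"
    proof
      assume "ed j = ed pj"
      then have "xs ! nx j = xs ! pj"
        using nx_neq(1)[OF j] inj[OF nx j] pj(2) unfolding ed_def by (metis doubleton_eq_iff)
      then show False using inj[OF nx pj(1)] nx_neq(2)[OF pj(1)] pj(2) nx_neq(2)[OF j] by metis
    qed
    ultimately show ?thesis unfolding degree_def by simp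
  qed
  then have "regular 2 (cyc xs)" unfolding regular_def V by auto
  with subg conn show ?thesis unfolding cycle_in_def by blast
qed

section \<open>Cycles as edge sets, and double covers from an injective side map\<close>

definition edge_graph :: "'v set set \<Rightarrow> 'v ugraph" where
  "edge_graph S = \<lparr>verts = \<Union>S, edges = S\<rparr>"

lemma edges_edge_graph [simp]: "edges (edge_graph S) = S"
  by (simp add: edge_graph_def)

text \<open>A cycle given by a list has no isolated vertices, so equality of cycles can be tested on
  edges alone, whatever the starting point and direction of the lists.\<close>

lemma cyc_eq_edge_graph: "cyc xs = edge_graph (edges (cyc xs))"
proof -
  have "\<Union> (edges (cyc xs)) = set xs"
  proof
    show "\<Union> (edges (cyc xs)) \<subseteq> set xs"
    proof
      fix v assume "v \<in> \<Union> (edges (cyc xs))"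
      then obtain i where "i < length xs" "v = xs ! i \<or> v = xs ! (Suc i mod length xs)"
        unfolding cyc_def by auto
      moreover from this have "Suc i mod length xs < length xs" by (intro mod_less_divisor) auto
      ultimately show "v \<in> set xs" by auto
    qed
    show "set xs \<subseteq> \<Union> (edges (cyc xs))" 
    proof
      fix v assume "v \<in> set xs"
      then obtain i where "i < length xs" "v = xs ! i" by (auto simp: in_set_conv_nth)
      then show "v \<in> \<Union> (edges (cyc xs))" unfolding cyc_def
        by (auto intro!: exI[of _ "{xs ! i, xs ! (Suc i mod length xs)}"])
    qed
  qed
  then show ?thesis by (simp add: edge_graph_def cyc_def)
qed

text \<open>Two face names with the same cycle would share both of these edges. Hence different
  names give different cycles, and the two faces at an edge do not collapse to one element of the
  cover.\<close>

lemma cycle_in_two_edges: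
  assumes "cycle_in H Z"
  shows "\<exists>e\<in>edges Z. \<exists>e'\<in>edges Z. e \<noteq> e'"
proof -
  obtain v where "v \<in> verts Z" using assms unfolding cycle_in_def connected_def by auto
  then have "card {e \<in> edges Z. v \<in> e} = 2"
    using assms unfolding cycle_in_def regular_def degree_def by auto
  then show ?thesis unfolding card_2_iff by blast
qed

text \<open>If every edge \<open>E e\<close> lies on exactly the two faces in \<open>sd e\<close>, then two faces share at most one
  edge as soon as \<open>sd\<close> is injective.\<close>

lemma induces_polyhedral_map_if_sides:
  assumes H: "cubic_graph H" "edges H = E ` EI" and E: "inj_on E EI"
    and F: "\<And>i. i \<in> I \<Longrightarrow> cycle_in H (F i)"
    and FE: "\<And>i. i \<in> I \<Longrightarrow> edges (F i) = E ` {e \<in> EI. i \<in> sd e}"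
    and sd: "\<And>e. e \<in> EI \<Longrightarrow> sd e \<subseteq> I \<and> card (sd e) = 2" and inj: "inj_on sd EI"
  shows "induces_polyhedral_map H (F ` I)"
proof -
  have mem: "E e \<in> edges (F i) \<longleftrightarrow> i \<in> sd e" if "i \<in> I" "e \<in> EI" for i e
    using FE[OF that(1)] E that(2) by (auto dest: inj_onD)
  have sd_eq: "sd e = {i, j}" if "e \<in> EI" "i \<in> sd e" "j \<in> sd e" "i \<noteq> j" for e i j
  proof -
    have "finite (sd e)" using sd[OF that(1)] by (metis card.infinite zero_neq_numeral)
    then have "{i, j} = sd e"
      using that sd[OF that(1)] by (intro card_subset_eq) auto
    then show ?thesis ..
  qed
  have common: "x = y" if i: "i \<in> I" and "j \<in> I" "i \<noteq> j"
    and xy: "x \<in> edges (F i) \<inter> edges (F j)" "y \<in> edges (F i) \<inter> edges (F j)" for i j x y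
  proof -
    obtain e where e: "e \<in> EI" "x = E e" using xy(1) unfolding FE[OF i] by auto
    obtain e' where e': "e' \<in> EI" "y = E e'" using xy(2) unfolding FE[OF i] by auto
    have "sd e = {i, j}" using that e mem by (intro sd_eq) auto
    moreover have "sd e' = {i, j}" using that e' mem by (intro sd_eq) auto
    ultimately have "sd e = sd e'" by simp
    then have "e = e'" using inj_onD[OF inj _ e(1) e'(1)] by simp
    then show ?thesis using e e' by simp
  qed
  have F_inj: "inj_on F I"
  proof (rule inj_onI, rule ccontr)
    fix i j assume ij: "i \<in> I" "j \<in> I" "F i = F j" "i \<noteq> j"
    obtain x y where "x \<in> edges (F i)" "y \<in> edges (F i)" "x \<noteq> y"
      using cycle_in_two_edges[OF F[OF ij(1)]] by blast
    then show False using common[of i j x y] ij by auto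
  qed
  have "card {Z \<in> F ` I. x \<in> edges Z} = 2" if x: "x \<in> edges H" for x
  proof -
    obtain e where e: "e \<in> EI" "x = E e" using x H(2) by blast
    have "{Z \<in> F ` I. x \<in> edges Z} = F ` sd e" using e(2) mem[OF _ e(1)] sd[OF e(1)] by blast
    moreover have "card (F ` sd e) = card (sd e)"
      using sd[OF e(1)] F_inj by (intro card_image) (auto intro: inj_on_subset)
    ultimately show ?thesis using sd[OF e(1)] by simp
  qed
  then have cdc: "cycle_double_cover H (F ` I)" using F unfolding cycle_double_cover_def by blast
  have "card (edges Z \<inter> edges Z') \<le> 1" if Z: "Z \<in> F ` I" "Z' \<in> F ` I" "Z \<noteq> Z'" for Z Z'
  proof -
    obtain i j where "i \<in> I" "j \<in> I" "Z = F i" "Z' = F j" "i \<noteq> j" using Z by blast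
    with common have "\<And>x y. x \<in> edges Z \<inter> edges Z' \<Longrightarrow> y \<in> edges Z \<inter> edges Z' \<Longrightarrow> x = y" by blast
    \<comment> \<open>\<open>card\<close> of an infinite set is 0, which settles the infinite
      case.\<close>
    then show ?thesis by (metis One_nat_def card_le_Suc0_iff_eq card.infinite le0)
  qed
  with cdc H show ?thesis unfolding induces_polyhedral_map_def by blast
qed

section \<open>Tracing walks given by blocks, and the sweep procedure\<close>

lemma walk_conv_nth:
  assumes ne: "\<And>n. b n \<noteq> []" and i: "i < length (concat (map b [0..<m]))"
  shows "walk b i = concat (map b [0..<m]) ! i"
proof -
  \<comment> \<open>Further blocks do not change the vertices already present, so any number of
    blocks that reaches position \<open>i\<close> gives the same vertex; \<open>walk\<close> takes
    \<open>i + 1\<close> of them.\<close>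
  have pre: "concat (map b [0..<m]) ! i = concat (map b [0..<m']) ! i"
    if "m \<le> m'" "i < length (concat (map b [0..<m]))" for m m'
  proof -
    have "[0..<m'] = [0..<m] @ [m..<m']" using that(1)
      by (metis le_add_diff_inverse upt_add_eq_append zero_le)
    then show ?thesis using that(2) by (simp add: nth_append)
  qed
  have len: "n \<le> length (concat (map b [0..<n]))" for n
  proof (induction n)
    case (Suc n)
    have "length (b n) \<ge> 1" using ne[of n] by (simp add: Suc_leI)
    then show ?case using Suc by simp
  qed simp
  have "i < length (concat (map b [0..<i + 1]))" using len[of "i + 1"] by simp
  then show ?thesis using i pre[of m "i + 1"] pre[of "i + 1" m] unfolding walk_def
    by (cases "m \<le> i + 1") auto
qed

text \<open>No vertex repeats within the first \<open>p\<close> blocks, and the vertex after them is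
  the head of \<open>b p = b 0\<close>. So the walk stops exactly when it closes up, and there is no
  tail leading into the cycle.\<close>

lemma traced_walk:
  assumes ne: "\<And>n. b n \<noteq> []" and p: "p > 0" "b p = b 0"
    and dist: "distinct (concat (map b [0..<p]))"
  shows "traced (walk b) = cyc (concat (map b [0..<p]))"
proof -
  define xs where "xs = concat (map b [0..<p])"
  define N where "N = length xs"
  have "xs = b 0 @ concat (map b [1..<p])"
    using p(1) upt_conv_Cons[of 0 p] unfolding xs_def by simp
  then have N: "N > 0" and x0: "xs ! 0 = b 0 ! 0" using ne[of 0] unfolding N_def
    by (auto simp: nth_append)
  have wi: "walk b i = xs ! i" if "i < N" for i
    using walk_conv_nth[where b = b and m = p, OF ne] that unfolding xs_def N_def by blast
  have xs': "concat (map b [0..<Suc p]) = xs @ b 0" using p(2) xs_def by simp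
  have wN: "walk b N = xs ! 0"
  proof -
    have "walk b N = (xs @ b 0) ! N" using walk_conv_nth[where b=b and m="Suc p" and i=N, OF ne]
      unfolding xs' using ne by (simp add: N_def)
    then show ?thesis using ne[of 0] by (simp add: N_def nth_append x0[unfolded N_def])
  qed
  have stop: "stop_time (walk b) = N"
    unfolding stop_time_def
  proof (rule Least_equality)
    show "walk b N \<in> walk b ` {..<N}" using wN wi[of 0] N by (metis imageI lessThan_iff)
    fix n assume n: "walk b n \<in> walk b ` {..<n}"
    show "N \<le> n"
    proof (rule ccontr)
      assume "\<not> N \<le> n"
      then have "xs ! n \<in> (!) xs ` {..<n}" using n wi by auto
      then show False using dist \<open>\<not> N \<le> n\<close> unfolding N_def xs_def[symmetric]
        by (auto simp: nth_eq_iff_index_eq)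
    qed
  qed
  have "walk b ` {..N} = set xs"
  proof -
    have "{..N} = insert N {..<N}" by auto
    moreover have "walk b ` {..<N} = (!) xs ` {..<N}" using wi by (intro image_cong) auto
    moreover have "set xs = (!) xs ` {..<N}" by (auto simp: set_conv_nth N_def)
    ultimately show ?thesis using wN N by auto
  qed
  moreover have "walk b (Suc i) = xs ! (Suc i mod N)" if "i < N" for i
    using that wN wi[of "Suc i"] by (cases "Suc i = N") auto
  then have "{{walk b i, walk b (Suc i)} | i. i < N} = {{xs ! i, xs ! (Suc i mod N)} | i. i < N}"
    using wi by (intro Collect_cong ex_cong1) auto
  ultimately show ?thesis unfolding traced_def stop cyc_def xs_def[symmetric] by (simp add: N_def)
qed

text \<open>A removed element has the same cycle as the element just picked, so its removal loses no
  cycle; this is why the result does not depend on \<open>ch\<close>. Since every pick visits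
  itself, each round shrinks the set and the loop ends.\<close>

lemma sweep_eq_image:
  assumes "finite T" and ch: "\<And>T'. T' \<subseteq> T \<Longrightarrow> T' \<noteq> {} \<Longrightarrow> ch T' \<in> T'"
    and vis: "\<And>x. x \<in> T \<Longrightarrow> x \<in> vis x" "\<And>x y. x \<in> T \<Longrightarrow> y \<in> T \<Longrightarrow> y \<in> vis x \<Longrightarrow> cy y = cy x"
  shows "sweep ch cy vis T = cy ` T"
proof -
  \<comment> \<open>Invariant: the cycles collected so far, together with those of the remaining
    elements, are all the cycles.\<close>
  define P where "P = (\<lambda>(U, Z). U \<subseteq> T \<and> Z \<union> cy ` U = cy ` T)"
  let ?st = "\<lambda>(U, Z). (U - vis (ch U), insert (cy (ch U)) Z)"
  have "P (while (\<lambda>(U, Z). U \<noteq> {}) ?st (T, {})) \<and> fst (while (\<lambda>(U, Z). U \<noteq> {}) ?st (T, {})) = {}"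
  proof (rule while_rule[where P = P and r = "measure (\<lambda>(U, Z). card U)"])
    fix t assume t: "P t" "case t of (U, Z) \<Rightarrow> U \<noteq> {}"
    obtain U Z where [simp]: "t = (U, Z)" by fastforce
    have U: "U \<subseteq> T" "U \<noteq> {}" "Z \<union> cy ` U = cy ` T" "ch U \<in> U"
      using t ch unfolding P_def by auto
    have "insert (cy (ch U)) (Z \<union> cy ` (U - vis (ch U))) = Z \<union> cy ` U"
    proof -
      have "cy y = cy (ch U)" if "y \<in> U" "y \<in> vis (ch U)" for y
        using that U vis(2)[of "ch U" y] by blast
      then have "insert (cy (ch U)) (cy ` (U - vis (ch U))) = cy ` U" using U(4) by blast
      then show ?thesis by blast
    qed
    then show "P (?st t)" using U unfolding P_def by auto
    have "U - vis (ch U) \<subset> U" using U vis(1)[of "ch U"] by blast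
    then show "(?st t, t) \<in> measure (\<lambda>(U, Z). card U)"
      using U(1) assms(1) by (auto intro!: psubset_card_mono intro: finite_subset)
  qed (auto simp: P_def)
  then show ?thesis unfolding sweep_def P_def by (auto simp: case_prod_unfold)
qed

section \<open>Orbits of injective self-maps of finite sets\<close>

definition orb :: "('x \<Rightarrow> 'x) \<Rightarrow> 'x \<Rightarrow> 'x set" where
  "orb f x = range (\<lambda>n. (f ^^ n) x)"

lemma orb_self [simp]: "x \<in> orb f x"
  unfolding orb_def by (rule range_eqI[of _ _ 0]) simp

lemma orb_subset: "f ` X \<subseteq> X \<Longrightarrow> x \<in> X \<Longrightarrow> orb f x \<subseteq> X"
proof -
  assume a: "f ` X \<subseteq> X" "x \<in> X"
  have "(f ^^ n) x \<in> X" for n using a by (induction n) auto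
  then show ?thesis unfolding orb_def by auto
qed

lemma orb_mono: "y \<in> orb f x \<Longrightarrow> orb f y \<subseteq> orb f x"
proof
  fix z assume "y \<in> orb f x" "z \<in> orb f y"
  then obtain m n where "y = (f ^^ m) x" "z = (f ^^ n) y" unfolding orb_def by blast
  then have "z = (f ^^ (n + m)) x" by (simp add: funpow_add)
  then show "z \<in> orb f x" unfolding orb_def by blast
qed

text \<open>By pigeonhole two iterates agree, and injectivity cancels their common steps until one
  of them is \<open>x\<close> itself. The least positive return time is therefore a true period, not
  preceded by a transient phase.\<close>

lemma orb_period:
  assumes "finite X" "inj_on f X" "f ` X \<subseteq> X" "x \<in> X"
  obtains p where "p > 0" "(f ^^ p) x = x" "inj_on (\<lambda>n. (f ^^ n) x) {..<p}"
    "orb f x = (\<lambda>n. (f ^^ n) x) ` {..<p}"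
proof -
  have inX: "(f ^^ n) x \<in> X" for n using orb_subset[OF assms(3,4)] unfolding orb_def by auto
  have shift: "(f ^^ (j - i)) x = x" if "i \<le> j" "(f ^^ i) x = (f ^^ j) x" for i j
    using that
  proof (induction i arbitrary: j)
    case (Suc i)
    obtain j' where j': "j = Suc j'" using Suc.prems by (cases j) auto
    then have "(f ^^ i) x = (f ^^ j') x" using Suc.prems inX assms(2) by (auto dest: inj_onD)
    then show ?case using Suc j' by auto
  qed simp
  have "\<exists>p>0. (f ^^ p) x = x"
  proof -
    have "\<not> inj (\<lambda>n. (f ^^ n) x)"
      using assms(1) inX finite_subset[of "range (\<lambda>n. (f ^^ n) x)" X]
      by (auto dest: finite_imageD)
    then obtain i j where "i < j" "(f ^^ i) x = (f ^^ j) x"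
      by (auto simp: inj_def) (metis nat_neq_iff)
    then show ?thesis using shift[of i j] by (intro exI[of _ "j - i"]) auto
  qed
  define p where "p = (LEAST p. p > 0 \<and> (f ^^ p) x = x)"
  have p: "p > 0" "(f ^^ p) x = x"
    using LeastI_ex[OF \<open>\<exists>p>0. (f ^^ p) x = x\<close>] unfolding p_def by auto
  have pmin: "p \<le> q" if "q > 0" "(f ^^ q) x = x" for q
    using that unfolding p_def by (intro Least_le) auto
  have inj: "inj_on (\<lambda>n. (f ^^ n) x) {..<p}"
  proof (rule linorder_inj_onI)
    fix i j :: nat assume "i < j" "i \<in> {..<p}" "j \<in> {..<p}"
    then show "(f ^^ i) x \<noteq> (f ^^ j) x" using shift[of i j] pmin[of "j - i"] by auto
  qed auto
  have "(f ^^ n) x = (f ^^ (n mod p)) x" for n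
    using p(2) by (metis funpow_mod_eq)
  then have "orb f x = (\<lambda>n. (f ^^ n) x) ` {..<p}"
    using p(1) unfolding orb_def by (auto simp: image_iff) (metis lessThan_iff mod_less_divisor)
  with that p inj show ?thesis by blast
qed

text \<open>From \<open>y\<close>, reached after \<open>m\<close> steps, the remaining
  \<open>p - m\<close> steps of the period lead back to \<open>x\<close>. So forward orbits are
  symmetric and partition \<open>X\<close>.\<close>

lemma orb_eq:
  assumes "finite X" "inj_on f X" "f ` X \<subseteq> X" "x \<in> X" "y \<in> orb f x"
  shows "orb f y = orb f x"
proof -
  obtain p where p: "p > 0" "(f ^^ p) x = x" "orb f x = (\<lambda>n. (f ^^ n) x) ` {..<p}"
    using orb_period[OF assms(1-4)] by metis
  obtain m where m: "m < p" "y = (f ^^ m) x" using assms(5) p by auto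
  have "x = (f ^^ (p - m)) y" using m p by (metis funpow_add comp_apply le_add_diff_inverse2 less_imp_le)
  then have "x \<in> orb f y" unfolding orb_def by blast
  then show ?thesis using orb_mono[OF assms(5)] orb_mono[of x f y] by simp
qed

lemma distinct_concat_upt:
  assumes "\<And>i. i < p \<Longrightarrow> distinct (b i)"
    and "\<And>i j. i < j \<Longrightarrow> j < p \<Longrightarrow> set (b i) \<inter> set (b j) = {}"
  shows "distinct (concat (map b [0..<p]))"
  using assms
proof (induction p)
  case (Suc p)
  have "set (concat (map b [0..<p])) \<inter> set (b p) = {}" using Suc.prems(2) by fastforce
  then show ?case using Suc by simp
qed simp

lemma step_in_orb: "y \<in> orb f x \<Longrightarrow> f y \<in> orb f x"
proof -
  assume "y \<in> orb f x"
  then obtain n where "y = (f ^^ n) x" unfolding orb_def by blast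
  then have "f y = (f ^^ Suc n) x" by simp
  then show ?thesis unfolding orb_def by blast
qed

text \<open>Going once round the orbit exhibits every point as an image. It allows edges named by
  the state after a step to be reindexed by the state before it.\<close>

lemma image_orb:
  assumes "finite X" "inj_on f X" "f ` X \<subseteq> X" "x \<in> X"
  shows "f ` orb f x = orb f x"
proof
  show "f ` orb f x \<subseteq> orb f x" by (auto intro: step_in_orb)
  obtain p where p: "p > 0" "(f ^^ p) x = x" using orb_period[OF assms] by metis
  show "orb f x \<subseteq> f ` orb f x"
  proof
    fix y assume "y \<in> orb f x"
    then obtain n where y: "y = (f ^^ n) x" unfolding orb_def by blast
    also have "\<dots> = (f ^^ (n + p)) x" using p(2) by (simp add: funpow_add)
    also have "\<dots> = f ((f ^^ (n + p - 1)) x)" using p(1) by (cases "n + p") simp_all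
    finally show "y \<in> f ` orb f x" unfolding orb_def by blast
  qed
qed

text \<open>The block of a state depends on the state only, and blocks of different states are
  disjoint, so one period of the orbit gives a list without repetitions. The resulting edge set is
  indexed by the orbit and forgets the starting point. The bound on the length covers orbits with a
  single element, where the cycle consists of one block.\<close>

lemma traced_orbit:
  assumes X: "finite X" "inj_on f X" "f ` X \<subseteq> X" "x \<in> X"
    and B: "\<And>y. y \<in> X \<Longrightarrow> B y \<noteq> []" "\<And>y. y \<in> X \<Longrightarrow> distinct (B y)"
    "\<And>y z. y \<in> X \<Longrightarrow> z \<in> X \<Longrightarrow> y \<noteq> z \<Longrightarrow> set (B y) \<inter> set (B z) = {}"
  obtains xs where "traced (walk (\<lambda>n. B ((f ^^ n) x))) = cyc xs" "distinct xs"
    "length xs \<ge> length (B x)"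
    "path_edges (xs @ [hd xs]) = (\<Union>y\<in>orb f x. path_edges (B y) \<union> {{last (B y), hd (B (f y))}})"
proof -
  obtain p where p: "p > 0" "(f ^^ p) x = x" "inj_on (\<lambda>n. (f ^^ n) x) {..<p}"
    "orb f x = (\<lambda>n. (f ^^ n) x) ` {..<p}" using orb_period[OF X] by metis
  define b where "b = (\<lambda>n. B ((f ^^ n) x))"
  define xs where "xs = concat (map b [0..<p])"
  have inX: "(f ^^ n) x \<in> X" for n using orb_subset[OF X(3,4)] unfolding orb_def by auto
  have dist: "distinct xs" unfolding xs_def
  proof (rule distinct_concat_upt)
    show "distinct (b i)" for i unfolding b_def using B(2) inX by blast
    show "set (b i) \<inter> set (b j) = {}" if "i < j" "j < p" for i j
      unfolding b_def using that inX p(3) by (intro B(3)) (auto dest: inj_onD)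
  qed
  have ne: "b n \<noteq> []" for n unfolding b_def using B(1) inX by blast
  have bp: "b p = b 0" unfolding b_def using p(2) by simp
  have xs0: "xs = b 0 @ concat (map b [1..<p])"
    using p(1) upt_conv_Cons[of 0 p] unfolding xs_def by simp
  have "hd xs = hd (b p)" using ne[of 0] unfolding xs0 bp by simp
  then have "path_edges (xs @ [hd xs]) = (\<Union>n<p. path_edges (b n) \<union> {{last (b n), hd (b (Suc n))}})"
    unfolding xs_def using path_edges_concat[of p b] ne by simp
  also have "\<dots> = (\<Union>y\<in>orb f x. path_edges (B y) \<union> {{last (B y), hd (B (f y))}})"
    unfolding p(4) b_def by simp
  finally have "path_edges (xs @ [hd xs]) = \<dots>" .
  moreover have "traced (walk b) = cyc xs"
    unfolding xs_def by (rule traced_walk[OF ne p(1) bp dist[unfolded xs_def]])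
  moreover have "length xs \<ge> length (B x)" unfolding xs0 b_def by simp
  ultimately show ?thesis using that dist unfolding b_def by blast
qed

section \<open>The edges of the graph \<open>D\<close>\<close>

text \<open>A triple \<open>(g, d, x)\<close> names the edge of type \<open>x\<close> belonging to the chain of \<open>(g, g s\<^sub>d)\<close>. The
  edges of the blow-ups are distributed over the chains: \<open>EA34\<close>, \<open>EA41\<close> and \<open>ECA\<close> lie in the blow-up
  of the target \<open>g s\<^sub>d\<close>, whereas \<open>ER 0\<close>, \<open>EAC\<close>, \<open>EC12\<close> and \<open>EC22\<close> lie in that of \<open>g\<close>. The
  indices of \<open>EU\<close>, \<open>EL\<close>, \<open>ER\<close> and \<open>Ladder\<close> start at \<open>0\<close> and include the link to the blow-up of \<open>g\<close>
  and the edge \<open>{4, 7}\<close>, so that the quadrangles at both ends of the ladder need no special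
  treatment.\<close>

datatype edge_label = EU nat | EL nat | ER nat
  | E01 | E02 | E03 | E13 | E16 | E24 | E25 | E35 | E58 | E69 | E78 | E89
  | E6A | E9A | EA34 | EA41 | ECA | EAC | EC12 | EC22

text \<open>Names instead of cycles make equality of bounded faces syntactic. Roof and base faces
  have no distinguished starting point and are named by their whole orbit. \<open>Oct g d\<close>
  lies between the superscripts \<open>d\<close> and \<open>nxt k d\<close> in the blow-up of
  \<open>g\<close>; it has 8, 6 or 4 edges for k \<ge> 3, \<open>k = 2\<close> and
  \<open>k = 1\<close>.\<close>

datatype 'a face = Ladder 'a nat nat | Tri 'a nat | Quad 'a nat | Pent 'a nat | Hex 'a nat
  | Finish 'a nat | Oct 'a nat | Centre 'a | Roof "('a \<times> nat) set" | Base "('a \<times> nat) set"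

locale cayley_blowup = group G for G (structure) +
  fixes k :: nat and s :: "nat \<Rightarrow> 'a"
  assumes fin: "finite (carrier G)" and k: "k \<ge> 1"
    and s_closed: "d \<in> {1..k} \<Longrightarrow> s d \<in> carrier G"
begin

abbreviation ch :: "'a \<Rightarrow> nat \<Rightarrow> label \<Rightarrow> 'a vertex" where
  "ch g d l \<equiv> Ch d g (g \<otimes> s d) l"

text \<open>The beginning of the upper path, with indices from 0 to \<open>Suc d\<close>. From
  \<open>Suc d\<close> on the function is constant, which is why statements on equality of its
  values bound the index.\<close>

definition upv :: "'a \<Rightarrow> nat \<Rightarrow> nat \<Rightarrow> 'a vertex" where
  "upv g d i = (if i = 0 then AV g d 1 else ch g d (if i \<le> d then Up i else Num 4))"

definition lov :: "'a \<Rightarrow> nat \<Rightarrow> nat \<Rightarrow> 'a vertex" where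
  "lov g d i = (if i = 0 then AV g d 2 else ch g d (if i \<le> d then Low i else Num 7))"

primrec ends :: "'a \<Rightarrow> nat \<Rightarrow> edge_label \<Rightarrow> 'a vertex set" where
  "ends g d (EU i) = {upv g d i, upv g d (Suc i)}"
| "ends g d (EL i) = {lov g d i, lov g d (Suc i)}"
| "ends g d (ER i) = {upv g d i, lov g d i}"
| "ends g d E01 = {ch g d (Num 0), ch g d (Num 1)}"
| "ends g d E02 = {ch g d (Num 0), ch g d (Num 2)}"
| "ends g d E03 = {ch g d (Num 0), ch g d (Num 3)}"
| "ends g d E13 = {ch g d (Num 1), ch g d (Num 3)}"
| "ends g d E16 = {ch g d (Num 1), ch g d (Num 6)}"
| "ends g d E24 = {ch g d (Num 2), ch g d (Num 4)}"
| "ends g d E25 = {ch g d (Num 2), ch g d (Num 5)}"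
| "ends g d E35 = {ch g d (Num 3), ch g d (Num 5)}"
| "ends g d E58 = {ch g d (Num 5), ch g d (Num 8)}"
| "ends g d E69 = {ch g d (Num 6), ch g d (Num 9)}"
| "ends g d E78 = {ch g d (Num 7), ch g d (Num 8)}"
| "ends g d E89 = {ch g d (Num 8), ch g d (Num 9)}"
| "ends g d E6A = {ch g d (Num 6), AV (g \<otimes> s d) d 4}"
| "ends g d E9A = {ch g d (Num 9), AV (g \<otimes> s d) d 3}"
| "ends g d EA34 = {AV (g \<otimes> s d) d 3, AV (g \<otimes> s d) d 4}"
| "ends g d EA41 = {AV (g \<otimes> s d) d 4, AV (g \<otimes> s d) (nxt k d) 1}"
| "ends g d ECA = {CV (g \<otimes> s d) d 1, AV (g \<otimes> s d) d 3}"
| "ends g d EAC = {AV g d 2, if k = 1 then AV g d 3 else CV g d 1}"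
| "ends g d EC12 = {CV g d 1, if k = 2 then CV g 2 1 else CV g d 2}"
| "ends g d EC22 = {CV g d 2, CV g (nxt k d) 2}"

text \<open>For \<open>k = 1\<close> the edges \<open>EAC\<close> and \<open>ECA\<close> merge into \<open>EAC\<close>; for \<open>k = 2\<close> the two edges \<open>EC12\<close> merge
  into the one with \<open>d = 1\<close>.\<close>

primrec label_ok :: "nat \<Rightarrow> edge_label \<Rightarrow> bool" where
  "label_ok d (EU i) \<longleftrightarrow> i \<le> d"
| "label_ok d (EL i) \<longleftrightarrow> i \<le> d"
| "label_ok d (ER i) \<longleftrightarrow> i \<le> Suc d"
| "label_ok d E01 \<longleftrightarrow> True"
| "label_ok d E02 \<longleftrightarrow> True"
| "label_ok d E03 \<longleftrightarrow> True"
| "label_ok d E13 \<longleftrightarrow> True"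
| "label_ok d E16 \<longleftrightarrow> True"
| "label_ok d E24 \<longleftrightarrow> True"
| "label_ok d E25 \<longleftrightarrow> True"
| "label_ok d E35 \<longleftrightarrow> True"
| "label_ok d E58 \<longleftrightarrow> True"
| "label_ok d E69 \<longleftrightarrow> True"
| "label_ok d E78 \<longleftrightarrow> True"
| "label_ok d E89 \<longleftrightarrow> True"
| "label_ok d E6A \<longleftrightarrow> True"
| "label_ok d E9A \<longleftrightarrow> True"
| "label_ok d EA34 \<longleftrightarrow> True"
| "label_ok d EA41 \<longleftrightarrow> True"
| "label_ok d ECA \<longleftrightarrow> k \<noteq> 1"
| "label_ok d EAC \<longleftrightarrow> True"
| "label_ok d EC12 \<longleftrightarrow> k \<ge> 3 \<or> k = 2 \<and> d = 1"
| "label_ok d EC22 \<longleftrightarrow> k \<ge> 3"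

definition edge_ids :: "('a \<times> nat \<times> edge_label) set" where
  "edge_ids = {(g, d, x). g \<in> carrier G \<and> d \<in> {1..k} \<and> label_ok d x}"

definition edge_of :: "'a \<times> nat \<times> edge_label \<Rightarrow> 'a vertex set" where
  "edge_of = (\<lambda>(g, d, x). ends g d x)"

definition prv :: "nat \<Rightarrow> nat" where
  "prv d = (if d = 1 then k else d - 1)"

lemma nxt_simps:
  assumes "d \<in> {1..k}"
  shows "nxt k d \<in> {1..k}" "prv d \<in> {1..k}" "nxt k (prv d) = d" "prv (nxt k d) = d"
    "nxt k d = d \<longleftrightarrow> k = 1" "prv d = d \<longleftrightarrow> k = 1"
  using assms unfolding nxt_def prv_def by auto

lemma nxt_inj: "d \<in> {1..k} \<Longrightarrow> d' \<in> {1..k} \<Longrightarrow> nxt k d = nxt k d' \<longleftrightarrow> d = d'"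
  unfolding nxt_def by auto

lemma nxt_nxt: "k \<ge> 3 \<Longrightarrow> d \<in> {1..k} \<Longrightarrow> nxt k (nxt k d) \<noteq> d"
  unfolding nxt_def by auto

lemma mult_s_cancel [simp]:
  "d \<in> {1..k} \<Longrightarrow> g \<in> carrier G \<Longrightarrow> g' \<in> carrier G \<Longrightarrow> g \<otimes> s d = g' \<otimes> s d \<longleftrightarrow> g = g'"
  using s_closed by simp

text \<open>Right multiplication by \<open>s d\<close> is onto, so every blow-up is the end of a
  chain of each colour. This justifies letting chains own the edges of the blow-up at their
  target.\<close>

lemma obtain_source:
  assumes "h \<in> carrier G" "d \<in> {1..k}"
  obtains g where "g \<in> carrier G" "h = g \<otimes> s d"
  using assms s_closed that[of "h \<otimes> inv (s d)"] by (simp add: m_assoc)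

lemma upv_eq [simp]:
  "upv g d i = AV g' d' j \<longleftrightarrow> i = 0 \<and> j = 1 \<and> g' = g \<and> d' = d"
  "AV g' d' j = upv g d i \<longleftrightarrow> i = 0 \<and> j = 1 \<and> g' = g \<and> d' = d"
  "upv g d i \<noteq> CV g' d' j" "CV g' d' j \<noteq> upv g d i"
  "upv g d i = Ch d' g' h (Up j) \<longleftrightarrow> d' = d \<and> g' = g \<and> h = g \<otimes> s d \<and> i \<noteq> 0 \<and> i \<le> d \<and> j = i"
  "Ch d' g' h (Up j) = upv g d i \<longleftrightarrow> d' = d \<and> g' = g \<and> h = g \<otimes> s d \<and> i \<noteq> 0 \<and> i \<le> d \<and> j = i"
  "upv g d i = Ch d' g' h (Num j) \<longleftrightarrow> d' = d \<and> g' = g \<and> h = g \<otimes> s d \<and> d < i \<and> j = 4"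
  "Ch d' g' h (Num j) = upv g d i \<longleftrightarrow> d' = d \<and> g' = g \<and> h = g \<otimes> s d \<and> d < i \<and> j = 4"
  "upv g d i \<noteq> Ch d' g' h (Low j)" "Ch d' g' h (Low j) \<noteq> upv g d i"
  "i \<le> Suc d \<Longrightarrow> i' \<le> Suc d' \<Longrightarrow> upv g d i = upv g' d' i' \<longleftrightarrow> g' = g \<and> d' = d \<and> i' = i"
  "upv g d i \<noteq> lov g' d' i'" "lov g' d' i' \<noteq> upv g d i"
  unfolding upv_def lov_def by auto

lemma lov_eq [simp]:
  "lov g d i = AV g' d' j \<longleftrightarrow> i = 0 \<and> j = 2 \<and> g' = g \<and> d' = d"
  "AV g' d' j = lov g d i \<longleftrightarrow> i = 0 \<and> j = 2 \<and> g' = g \<and> d' = d"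
  "lov g d i \<noteq> CV g' d' j" "CV g' d' j \<noteq> lov g d i"
  "lov g d i = Ch d' g' h (Low j) \<longleftrightarrow> d' = d \<and> g' = g \<and> h = g \<otimes> s d \<and> i \<noteq> 0 \<and> i \<le> d \<and> j = i"
  "Ch d' g' h (Low j) = lov g d i \<longleftrightarrow> d' = d \<and> g' = g \<and> h = g \<otimes> s d \<and> i \<noteq> 0 \<and> i \<le> d \<and> j = i"
  "lov g d i = Ch d' g' h (Num j) \<longleftrightarrow> d' = d \<and> g' = g \<and> h = g \<otimes> s d \<and> d < i \<and> j = 7"
  "Ch d' g' h (Num j) = lov g d i \<longleftrightarrow> d' = d \<and> g' = g \<and> h = g \<otimes> s d \<and> d < i \<and> j = 7"
  "lov g d i \<noteq> Ch d' g' h (Up j)" "Ch d' g' h (Up j) \<noteq> lov g d i"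
  "i \<le> Suc d \<Longrightarrow> i' \<le> Suc d' \<Longrightarrow> lov g d i = lov g' d' i' \<longleftrightarrow> g' = g \<and> d' = d \<and> i' = i"
  unfolding lov_def by auto

text \<open>The facts about \<open>nxt\<close> enter as hypotheses, so that the split over pairs of
  labels can treat \<open>nxt\<close> as an arbitrary function. The last one is for
  \<open>EC22\<close>: if \<open>nxt k (nxt k d) = d\<close>, the edges belonging to
  \<open>d\<close> and to \<open>nxt k d\<close> would coincide.\<close>

lemma ends_inj:
  "label_ok d x \<Longrightarrow> label_ok d' x' \<Longrightarrow> ends g d x = ends g' d' x' \<Longrightarrow>
   g \<in> carrier G \<Longrightarrow> d \<in> {1..k} \<Longrightarrow> g' \<in> carrier G \<Longrightarrow> d' \<in> {1..k} \<Longrightarrow>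
   (nxt k d = nxt k d' \<longleftrightarrow> d = d') \<Longrightarrow> (k \<ge> 3 \<Longrightarrow> nxt k (nxt k d) \<noteq> d) \<Longrightarrow>
   g = g' \<and> d = d' \<and> x = x'"
  by (cases x; cases x'; simp add: doubleton_eq_iff split: if_splits; auto?)

lemma inj_on_edge_of: "inj_on edge_of edge_ids"
proof (rule inj_onI)
  fix e e' assume e: "e \<in> edge_ids" "e' \<in> edge_ids" "edge_of e = edge_of e'"
  obtain g d x g' d' x' where ee: "e = (g, d, x)" "e' = (g', d', x')" by (metis prod_cases3)
  have *: "d \<in> {1..k}" "d' \<in> {1..k}" using e unfolding ee edge_ids_def by blast+
  have "g = g' \<and> d = d' \<and> x = x'"
    using e nxt_inj[OF *] nxt_nxt[OF _ *(1)] unfolding ee edge_ids_def edge_of_def mem_Collect_eq prod.case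
    by (intro ends_inj) blast+
  then show "e = e'" by (simp add: ee)
qed

abbreviation "DG \<equiv> D_graph G k s"

lemma Union_cayley_edges:
  "(\<Union>(d, g, h)\<in>cayley_edges G k s. f d g h) = (\<Union>d\<in>{1..k}. \<Union>g\<in>carrier G. f d g (g \<otimes> s d))"
  unfolding cayley_edges_def by blast

lemma mult_s_closed [simp]: "g \<in> carrier G \<Longrightarrow> d \<in> {1..k} \<Longrightarrow> g \<otimes> s d \<in> carrier G"
  using s_closed by simp

lemma edges_DG_eq:
  "edges DG = (\<Union>g\<in>carrier G. edges (blowup k g)) \<union>
     (\<Union>d\<in>{1..k}. \<Union>g\<in>carrier G. edges (chain d g (g \<otimes> s d)) \<union> link_edges d g (g \<otimes> s d))"
  unfolding D_graph_def by (simp add: Union_cayley_edges)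

lemma verts_DG_eq:
  "verts DG = (\<Union>g\<in>carrier G. verts (blowup k g)) \<union>
     (\<Union>d\<in>{1..k}. \<Union>g\<in>carrier G. verts (chain d g (g \<otimes> s d)))"
  unfolding D_graph_def by (simp add: Union_cayley_edges)

section \<open>Edges and vertices of the graph in terms of names\<close>

definition chain_edge_labels :: "nat \<Rightarrow> edge_label set" where
  "chain_edge_labels d = EU ` {..d} \<union> EL ` {..d} \<union> ER ` {1..Suc d} \<union>
     {E01, E02, E03, E13, E16, E24, E25, E35, E58, E69, E78, E89, E6A, E9A}"

lemma edges_chain:
  assumes "d \<ge> 1"
  shows "edges (chain d g (g \<otimes> s d)) \<union> link_edges d g (g \<otimes> s d) = ends g d ` chain_edge_labels d"
proof -
  \<comment> \<open>The extreme indices are split off: 0 stands for the links to the source blow-up,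
    \<open>d\<close> for the edges to the vertices 4 and 7, and \<open>Suc d\<close> for the rung
    between 4 and 7. The ranges in between are those of the chain itself.\<close>
  have 1: "{..d} = insert 0 (insert d {1..<d})" "{1..Suc d} = insert (Suc d) {1..d}"
    using assms by auto
  have u: "(\<lambda>i. ends g d (EU i)) ` {1..<d} = (`) (Ch d g (g \<otimes> s d)) ` {{Up i, Up (i+1)} | i. 1 \<le> i \<and> i < d}"
  proof -
    have eq: "{{Up i, Up (i+1)} | i. 1 \<le> i \<and> i < d} = (\<lambda>i. {Up i, Up (i+1)}) ` {1..<d}" by auto
    show ?thesis unfolding eq image_image by (rule image_cong) (auto simp: upv_def lov_def)
  qed
  have l: "(\<lambda>i. ends g d (EL i)) ` {1..<d} = (`) (Ch d g (g \<otimes> s d)) ` {{Low i, Low (i+1)} | i. 1 \<le> i \<and> i < d}"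
  proof -
    have eq: "{{Low i, Low (i+1)} | i. 1 \<le> i \<and> i < d} = (\<lambda>i. {Low i, Low (i+1)}) ` {1..<d}" by auto
    show ?thesis unfolding eq image_image by (rule image_cong) (auto simp: upv_def lov_def)
  qed
  have r: "(\<lambda>i. ends g d (ER i)) ` {1..d} = (`) (Ch d g (g \<otimes> s d)) ` {{Up i, Low i} | i. 1 \<le> i \<and> i \<le> d}"
  proof -
    have eq: "{{Up i, Low i} | i. 1 \<le> i \<and> i \<le> d} = (\<lambda>i. {Up i, Low i}) ` {1..d}" by auto
    show ?thesis unfolding eq image_image by (rule image_cong) (auto simp: upv_def lov_def)
  qed
  have link: "ends g d ` {EU 0, EL 0, E6A, E9A} = link_edges d g (g \<otimes> s d)"
    using assms by (simp add: link_edges_def upv_def lov_def)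
  have ul: "ends g d ` {EU d, EL d} = (`) (Ch d g (g \<otimes> s d)) ` {{Up d, Num 4}, {Low d, Num 7}}"
    using assms by (simp add: upv_def lov_def)
  have num: "ends g d ` {E01, E02, E03, E13, E16, E24, E25, E35, ER (Suc d), E58, E69, E78, E89}
     = (`) (Ch d g (g \<otimes> s d)) ` {{Num 0, Num 1}, {Num 0, Num 2}, {Num 0, Num 3}, {Num 1, Num 3}, {Num 1, Num 6},
      {Num 2, Num 4}, {Num 2, Num 5}, {Num 3, Num 5}, {Num 4, Num 7}, {Num 5, Num 8},
      {Num 6, Num 9}, {Num 7, Num 8}, {Num 8, Num 9}}"
    by (simp add: upv_def lov_def)
  have "chain_edge_labels d = EU ` {1..<d} \<union> EL ` {1..<d} \<union> ER ` {1..d} \<union> {EU d, EL d} \<union>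
      {E01, E02, E03, E13, E16, E24, E25, E35, ER (Suc d), E58, E69, E78, E89} \<union> {EU 0, EL 0, E6A, E9A}"
    unfolding chain_edge_labels_def 1 image_insert by blast
  then have "ends g d ` chain_edge_labels d = (\<lambda>i. ends g d (EU i)) ` {1..<d} \<union>
      (\<lambda>i. ends g d (EL i)) ` {1..<d} \<union> (\<lambda>i. ends g d (ER i)) ` {1..d} \<union> ends g d ` {EU d, EL d} \<union>
      ends g d ` {E01, E02, E03, E13, E16, E24, E25, E35, ER (Suc d), E58, E69, E78, E89} \<union>
      ends g d ` {EU 0, EL 0, E6A, E9A}"
    by (simp only: image_Un image_image)
  then show ?thesis unfolding u l r ul num link chain_def chain_label_edges_def ugraph.simps
    by (simp only: image_Un)
qed

text \<open>The edges are stated with the same conditionals as in \<open>ends\<close>, so the three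
  shapes of a blow-up need not be distinguished again when a name is shown to denote an
  edge.\<close>

lemma in_edges_blowup:
  assumes d: "d \<in> {1..k}"
  shows "{AV g d 1, AV g d 2} \<in> edges (blowup k g)" "{AV g d 3, AV g d 4} \<in> edges (blowup k g)"
    "{AV g d 4, AV g (nxt k d) 1} \<in> edges (blowup k g)"
    "{AV g d 2, if k = 1 then AV g d 3 else CV g d 1} \<in> edges (blowup k g)"
    "k \<noteq> 1 \<Longrightarrow> {CV g d 1, AV g d 3} \<in> edges (blowup k g)"
    "k \<ge> 3 \<or> k = 2 \<and> d = 1 \<Longrightarrow> {CV g d 1, if k = 2 then CV g 2 1 else CV g d 2} \<in> edges (blowup k g)"
    "k \<ge> 3 \<Longrightarrow> {CV g d 2, CV g (nxt k d) 2} \<in> edges (blowup k g)"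
proof -
  have "{AV g d 1, AV g d 2} \<in> edges (blowup k g) \<and> {AV g d 3, AV g d 4} \<in> edges (blowup k g) \<and>
    {AV g d 4, AV g (nxt k d) 1} \<in> edges (blowup k g) \<and>
    {AV g d 2, if k = 1 then AV g d 3 else CV g d 1} \<in> edges (blowup k g) \<and>
    (k \<noteq> 1 \<longrightarrow> {CV g d 1, AV g d 3} \<in> edges (blowup k g)) \<and>
    (k \<ge> 3 \<or> k = 2 \<and> d = 1 \<longrightarrow>
      {CV g d 1, if k = 2 then CV g 2 1 else CV g d 2} \<in> edges (blowup k g)) \<and>
    (k \<ge> 3 \<longrightarrow> {CV g d 2, CV g (nxt k d) 2} \<in> edges (blowup k g))" (is ?P)
  proof -
    consider "k \<ge> 3" | "k = 2" "d = 1" | "k = 2" "d = 2" | "k = 1" "d = 1" using d by fastforce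
    then show ?P
    proof cases
      case 1
      then have "{{AV g d 1, AV g d 2}, {AV g d 2, CV g d 1}, {CV g d 1, AV g d 3},
          {AV g d 3, AV g d 4}, {CV g d 1, CV g d 2}, {CV g d 2, CV g (nxt k d) 2},
          {AV g d 4, AV g (nxt k d) 1}} \<subseteq> edges (blowup k g)"
        unfolding blowup_def by (simp only: if_True ugraph.simps) (rule UN_upper[OF d])
      with 1 show ?thesis by simp
    qed (simp_all add: blowup_def nxt_def)
  qed
  then show "{AV g d 1, AV g d 2} \<in> edges (blowup k g)" "{AV g d 3, AV g d 4} \<in> edges (blowup k g)"
    "{AV g d 4, AV g (nxt k d) 1} \<in> edges (blowup k g)"
    "{AV g d 2, if k = 1 then AV g d 3 else CV g d 1} \<in> edges (blowup k g)"
    "k \<noteq> 1 \<Longrightarrow> {CV g d 1, AV g d 3} \<in> edges (blowup k g)"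
    "k \<ge> 3 \<or> k = 2 \<and> d = 1 \<Longrightarrow> {CV g d 1, if k = 2 then CV g 2 1 else CV g d 2} \<in> edges (blowup k g)"
    "k \<ge> 3 \<Longrightarrow> {CV g d 2, CV g (nxt k d) 2} \<in> edges (blowup k g)" by blast+
qed

lemma edges_DG: "edges DG = edge_of ` edge_ids"
proof
  have idI: "ends g d x \<in> edge_of ` edge_ids" if "g \<in> carrier G" "d \<in> {1..k}" "label_ok d x" for g d x
    using that unfolding edge_of_def edge_ids_def by (intro image_eqI[of _ _ "(g, d, x)"]) auto
  show "edges DG \<subseteq> edge_of ` edge_ids"
  proof -
    have "edges (chain d g (g \<otimes> s d)) \<union> link_edges d g (g \<otimes> s d) \<subseteq> edge_of ` edge_ids"
      if "g \<in> carrier G" "d \<in> {1..k}" for g d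
    proof -
      have "d \<ge> 1" using that by simp
      then show ?thesis unfolding edges_chain[OF \<open>d \<ge> 1\<close>]
        using that by (auto simp: chain_edge_labels_def simp del: ends.simps intro!: idI)
    qed
    moreover have "edges (blowup k h) \<subseteq> edge_of ` edge_ids" if h: "h \<in> carrier G" for h
    proof -
      \<comment> \<open>These edges of the blow-up of \<open>h\<close> are owned by the chain of
        colour \<open>d\<close> that ends there, so its source has to be found.\<close>
      have t: "{AV h d 3, AV h d 4} \<in> edge_of ` edge_ids \<and> {AV h d 4, AV h (nxt k d) 1} \<in> edge_of ` edge_ids \<and>
          (k \<noteq> 1 \<longrightarrow> {CV h d 1, AV h d 3} \<in> edge_of ` edge_ids)" if d: "d \<in> {1..k}" for d
      proof -
        obtain g where g: "g \<in> carrier G" "h = g \<otimes> s d" using h d by (rule obtain_source)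
        then show ?thesis using idI[OF g(1) d, of EA34] idI[OF g(1) d, of EA41] idI[OF g(1) d, of ECA]
          by simp
      qed
      have o: "{AV h d 1, AV h d 2} \<in> edge_of ` edge_ids \<and>
         {AV h d 2, if k = 1 then AV h d 3 else CV h d 1} \<in> edge_of ` edge_ids \<and>
         (k \<ge> 3 \<longrightarrow> {CV h d 1, CV h d 2} \<in> edge_of ` edge_ids \<and> {CV h d 2, CV h (nxt k d) 2} \<in> edge_of ` edge_ids)"
        if d: "d \<in> {1..k}" for d
        using idI[OF h d, of "ER 0"] idI[OF h d, of EAC] idI[OF h d, of EC12] idI[OF h d, of EC22]
        by (auto simp: upv_def lov_def)
      have c2: "{CV h 1 1, CV h 2 1} \<in> edge_of ` edge_ids" if "k = 2"
      proof -
        have "ends h 1 EC12 = {CV h 1 1, CV h 2 1}" unfolding ends.simps using that by simp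
        moreover have "label_ok 1 EC12" unfolding label_ok.simps using that by simp
        ultimately show ?thesis using idI[OF h, of 1 EC12] k by simp
      qed
      consider "k \<ge> 3" | "k = 2" | "k = 1" using k by linarith
      then show ?thesis
      proof cases
        case 1
        then show ?thesis using t o unfolding blowup_def by (simp add: UN_subset_iff)
      next
        case 2
        then show ?thesis using t[of 1] t[of 2] o[of 1] o[of 2] c2 unfolding blowup_def by simp
      next
        case 3
        then show ?thesis using t[of 1] o[of 1] unfolding blowup_def by (simp add: nxt_def)
      qed
    qed
    ultimately show ?thesis unfolding edges_DG_eq
      by (intro Un_least UN_least) blast+
  qed
  show "edge_of ` edge_ids \<subseteq> edges DG"
  proof -
    have "ends g d x \<in> edges DG" if g: "g \<in> carrier G" and d: "d \<in> {1..k}" and ok: "label_ok d x" for g d x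
    proof -
      have d1: "d \<ge> 1" using d by simp
      have c: ?thesis if "x \<in> chain_edge_labels d"
      proof -
        have "ends g d x \<in> edges (chain d g (g \<otimes> s d)) \<union> link_edges d g (g \<otimes> s d)"
          unfolding edges_chain[OF d1] using that by blast
        then show ?thesis using g d unfolding edges_DG_eq by blast
      qed
      have b: ?thesis if "ends g d x \<in> edges (blowup k g) \<or> ends g d x \<in> edges (blowup k (g \<otimes> s d))"
        using g mult_s_closed[OF g d] that unfolding edges_DG_eq by blast
      note in_blowup = in_edges_blowup[OF d, of g] in_edges_blowup[OF d, of "g \<otimes> s d"]
      have "x \<in> chain_edge_labels d \<or> x \<in> {ER 0, EA34, EA41, ECA, EAC, EC12, EC22}"
        using ok by (cases x) (auto simp: chain_edge_labels_def)
      then consider "x \<in> chain_edge_labels d" | "x = ER 0" | "x = EA34" | "x = EA41"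
        | "x = ECA" | "x = EAC" | "x = EC12" | "x = EC22" by blast
      then show ?thesis
      proof cases
        case 1
        then show ?thesis by (rule c)
      next
        case 2
        then show ?thesis using in_blowup(1) b by (simp add: upv_def lov_def)
      next
        case 3
        then show ?thesis using in_blowup(9) b by simp
      next
        case 4
        then show ?thesis using in_blowup(10) b by simp
      next
        case 5
        then show ?thesis using in_blowup(12) b ok by simp
      next
        case 6
        then show ?thesis using in_blowup(4) b unfolding 6 ends.simps by blast
      next
        case 7
        then show ?thesis using in_blowup(6) b ok unfolding 7 ends.simps label_ok.simps by blast
      next
        case 8
        then show ?thesis using in_blowup(7) b ok by simp
      qed
    qed
    then show ?thesis unfolding edge_of_def edge_ids_def by auto
  qed
qed

text \<open>A loop of the Cayley graph does not produce a loop here: the two ends differ in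
  constructor, superscript or chain label. Only \<open>EC22\<close> depends on
  \<open>nxt k d\<close> differing from \<open>d\<close>.\<close>

lemma card_edge_of: "e \<in> edge_ids \<Longrightarrow> card (edge_of e) = 2"
proof -
  assume "e \<in> edge_ids"
  then obtain g d x where e: "e = (g, d, x)" "g \<in> carrier G" "d \<in> {1..k}" "label_ok d x"
    unfolding edge_ids_def by auto
  have "k \<ge> 3 \<Longrightarrow> nxt k d \<noteq> d" using nxt_simps(5)[OF e(3)] by auto
  then have "card (ends g d x) = 2" using e(4) by (cases x) auto
  then show ?thesis unfolding edge_of_def e(1) by simp
qed

lemma in_verts_DG:
  assumes "g \<in> carrier G" "d \<in> {1..k}"
  shows "j \<in> {1,2,3,4} \<Longrightarrow> AV g d j \<in> verts DG"
    "k \<ge> 2 \<Longrightarrow> CV g d 1 \<in> verts DG" "k \<ge> 3 \<Longrightarrow> CV g d 2 \<in> verts DG"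
    "i \<le> Suc d \<Longrightarrow> upv g d i \<in> verts DG" "i \<le> Suc d \<Longrightarrow> lov g d i \<in> verts DG"
    "n \<le> 9 \<Longrightarrow> ch g d (Num n) \<in> verts DG"
proof -
  have b: "v \<in> verts DG" if "v \<in> verts (blowup k g)" for v
    using that assms unfolding verts_DG_eq by blast
  have c: "v \<in> verts DG" if "v \<in> verts (chain d g (g \<otimes> s d))" for v
    using that assms unfolding verts_DG_eq by blast
  have "(\<forall>j\<in>{1,2,3,4}. AV g d j \<in> verts (blowup k g)) \<and> (k \<ge> 2 \<longrightarrow> CV g d 1 \<in> verts (blowup k g)) \<and>
      (k \<ge> 3 \<longrightarrow> CV g d 2 \<in> verts (blowup k g))"
  proof -
    consider "k \<ge> 3" | "k = 2" "d = 1" | "k = 2" "d = 2" | "k = 1" "d = 1" using assms k by fastforce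
    then show ?thesis using assms(2) unfolding blowup_def by cases auto
  qed
  then show A: "j \<in> {1,2,3,4} \<Longrightarrow> AV g d j \<in> verts DG" and "k \<ge> 2 \<Longrightarrow> CV g d 1 \<in> verts DG"
      "k \<ge> 3 \<Longrightarrow> CV g d 2 \<in> verts DG" for j
    using b by blast+
  show N: "n \<le> 9 \<Longrightarrow> ch g d (Num n) \<in> verts DG" for n
    by (intro c) (auto simp: chain_def chain_labels_def)
  show "i \<le> Suc d \<Longrightarrow> upv g d i \<in> verts DG"
    using A[of 1] N[of 4] c[of "ch g d (Up i)"] by (auto simp: upv_def chain_def chain_labels_def)
  show "i \<le> Suc d \<Longrightarrow> lov g d i \<in> verts DG"
    using A[of 2] N[of 7] c[of "ch g d (Low i)"] by (auto simp: lov_def chain_def chain_labels_def)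
qed

lemma fin_DG: "fin_ugraph DG"
proof -
  have "finite (verts (blowup k g))" for g :: 'a unfolding blowup_def by simp
  moreover have "finite (verts (chain d g h))" for d and g h :: 'a unfolding chain_def chain_labels_def by simp
  ultimately have "finite (verts DG)" unfolding verts_DG_eq using fin by simp
  moreover have "edge_of e \<subseteq> verts DG" if "e \<in> edge_ids" for e
  proof -
    obtain g d x where e: "e = (g, d, x)" "g \<in> carrier G" "d \<in> {1..k}" "label_ok d x"
      using \<open>e \<in> edge_ids\<close> unfolding edge_ids_def by auto
    define V where "V = verts DG"
    note i = in_verts_DG[OF e(2,3), folded V_def]
      in_verts_DG[OF mult_s_closed[OF e(2,3)] e(3), folded V_def]
      in_verts_DG[OF mult_s_closed[OF e(2,3)] nxt_simps(1)[OF e(3)], folded V_def]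
      in_verts_DG[OF e(2) nxt_simps(1)[OF e(3)], folded V_def]
    have "k = 2 \<Longrightarrow> CV g 2 1 \<in> V" using in_verts_DG(2)[OF e(2), of 2, folded V_def] by simp
    with e(4) k show ?thesis unfolding edge_of_def e(1) prod.case V_def[symmetric]
      by (cases x) (simp_all add: i[unfolded One_nat_def], auto simp: i[unfolded One_nat_def])
  qed
  ultimately show ?thesis using card_edge_of unfolding fin_ugraph_def edges_DG by auto
qed

section \<open>The graph \<open>D\<close> is cubic\<close>

lemma verts_DG_cases:
  assumes "v \<in> verts DG"
  obtains g d where "g \<in> carrier G" "d \<in> {1..k}" "v = AV g d 1"
  | g d where "g \<in> carrier G" "d \<in> {1..k}" "v = AV g d 2"
  | g d where "g \<in> carrier G" "d \<in> {1..k}" "v = AV g d 3"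
  | g d where "g \<in> carrier G" "d \<in> {1..k}" "v = AV g d 4"
  | g d where "g \<in> carrier G" "d \<in> {1..k}" "k \<ge> 2" "v = CV g d 1"
  | g d where "g \<in> carrier G" "d \<in> {1..k}" "k \<ge> 3" "v = CV g d 2"
  | g d i where "g \<in> carrier G" "d \<in> {1..k}" "i \<in> {1..d}" "v = ch g d (Up i)"
  | g d i where "g \<in> carrier G" "d \<in> {1..k}" "i \<in> {1..d}" "v = ch g d (Low i)"
  | g d n where "g \<in> carrier G" "d \<in> {1..k}" "n \<in> {0..9}" "v = ch g d (Num n)"
proof -
  define W where "W = (\<lambda>(g :: 'a) d. if k \<ge> 3 then {AV g d 1, AV g d 2, AV g d 3, AV g d 4, CV g d 1, CV g d 2}
      else if k = 2 then {AV g d 1, AV g d 2, AV g d 3, AV g d 4, CV g d 1}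
      else {AV g d 1, AV g d 2, AV g d 3, AV g d 4})"
  have W: "verts (blowup k g) \<subseteq> (\<Union>d\<in>{1..k}. W g d)" for g :: 'a
  proof -
    consider "k \<ge> 3" | "k = 2" "{1..k} = {1, 2}" | "k = 1" "{1..k} = {1}" using k by fastforce
    then show ?thesis by cases (simp_all add: blowup_def W_def)
  qed
  consider g where "g \<in> carrier G" "v \<in> verts (blowup k g)"
    | g d where "g \<in> carrier G" "d \<in> {1..k}" "v \<in> verts (chain d g (g \<otimes> s d))"
    using assms unfolding verts_DG_eq by blast
  then show ?thesis
  proof cases
    case (1 g)
    obtain d where d: "d \<in> {1..k}" "v \<in> W g d" using W[of g] 1(2) by blast
    then have "v \<in> {AV g d 1, AV g d 2, AV g d 3, AV g d 4} \<or> k \<ge> 2 \<and> v = CV g d 1 \<or> k \<ge> 3 \<and> v = CV g d 2"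
      unfolding W_def by (simp split: if_splits)
    then show ?thesis using that(1-6)[OF 1(1) d(1)] by blast
  next
    case (2 g d)
    then show ?thesis using that(7-9)[OF 2(1,2)] unfolding chain_def chain_labels_def ugraph.simps
      by (elim imageE UnE) simp_all
  qed
qed

text \<open>Degrees are counted on names of edges, where incidence can be decided label by label;
  injectivity of \<open>edge_of\<close> carries the count over to edges.\<close>

lemma card_incidentI:
  assumes "S \<subseteq> edge_ids" "card S = 3"
    and "\<And>g d x. g \<in> carrier G \<Longrightarrow> d \<in> {1..k} \<Longrightarrow> label_ok d x \<Longrightarrow> v \<in> ends g d x \<longleftrightarrow> (g, d, x) \<in> S"
  shows "card {e \<in> edge_ids. v \<in> edge_of e} = 3"
proof -
  have "v \<in> edge_of e \<longleftrightarrow> e \<in> S" if "e \<in> edge_ids" for e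
    using that assms(3) unfolding edge_of_def edge_ids_def by auto
  then have "{e \<in> edge_ids. v \<in> edge_of e} = S" using assms(1) by blast
  then show ?thesis using assms(2) by simp
qed

lemma card_incident_chain:
  assumes g: "g \<in> carrier G" and d: "d \<in> {1..k}"
  shows "i \<in> {1..d} \<Longrightarrow> card {e \<in> edge_ids. ch g d (Up i) \<in> edge_of e} = 3"
    "i \<in> {1..d} \<Longrightarrow> card {e \<in> edge_ids. ch g d (Low i) \<in> edge_of e} = 3"
    "n \<in> {0..9} \<Longrightarrow> card {e \<in> edge_ids. ch g d (Num n) \<in> edge_of e} = 3"
proof -
  note * = card_incidentI[of "(\<lambda>x. (g, d, x)) ` {a, b, c}" for a b c]
  have "card {e \<in> edge_ids. ch g d (Up i) \<in> edge_of e} = 3" if "i \<in> {1..d}" for i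
  \<comment> \<open>\<open>EU i\<close> runs from index \<open>i\<close> to \<open>Suc i\<close>, so
    index \<open>i\<close> is also the upper end of \<open>EU (i - 1)\<close>. Since index 0 is the
    link, the vertex with \<open>i = 1\<close> is no exception.\<close>
  proof (rule *[of "EU (i - 1)" "EU i" "ER i"])
    fix g' d' x
    show "ch g d (Up i) \<in> ends g' d' x \<longleftrightarrow> (g', d', x) \<in> (\<lambda>x. (g, d, x)) ` {EU (i - 1), EU i, ER i}"
      if "label_ok d' x" using that \<open>i \<in> _\<close> by (cases x) auto
  qed (use g d that in \<open>auto simp: edge_ids_def\<close>)
  then show "i \<in> {1..d} \<Longrightarrow> card {e \<in> edge_ids. ch g d (Up i) \<in> edge_of e} = 3" .
  have "card {e \<in> edge_ids. ch g d (Low i) \<in> edge_of e} = 3" if "i \<in> {1..d}" for i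
  proof (rule *[of "EL (i - 1)" "EL i" "ER i"])
    fix g' d' x
    show "ch g d (Low i) \<in> ends g' d' x \<longleftrightarrow> (g', d', x) \<in> (\<lambda>x. (g, d, x)) ` {EL (i - 1), EL i, ER i}"
      if "label_ok d' x" using that \<open>i \<in> _\<close> by (cases x) auto
  qed (use g d that in \<open>auto simp: edge_ids_def\<close>)
  then show "i \<in> {1..d} \<Longrightarrow> card {e \<in> edge_ids. ch g d (Low i) \<in> edge_of e} = 3" .
  \<comment> \<open>Row \<open>n\<close> lists the three edges at the vertex labelled
    \<open>n\<close>. The vertices 4 and 7 are ends of the ladder, hence the labels
    \<open>EU d\<close>, \<open>EL d\<close> and \<open>ER (Suc d)\<close>.\<close>
  define S where "S n = [{E01, E02, E03}, {E01, E13, E16}, {E02, E24, E25}, {E03, E13, E35},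
    {EU d, E24, ER (Suc d)}, {E25, E35, E58}, {E16, E69, E6A}, {EL d, E78, ER (Suc d)},
    {E58, E78, E89}, {E69, E89, E9A}] ! n" for n
  have num: "n \<in> {0,1,2,3,4,5,6,7,8,9}" if "n \<in> {0..9}" for n :: nat using that by auto
  have "card {e \<in> edge_ids. ch g d (Num n) \<in> edge_of e} = 3" if "n \<in> {0..9}" for n
  proof (rule card_incidentI[of "(\<lambda>x. (g, d, x)) ` S n"])
    show "(\<lambda>x. (g, d, x)) ` S n \<subseteq> edge_ids" "card ((\<lambda>x. (g, d, x)) ` S n) = 3"
      using num[OF that] g d by (auto simp: edge_ids_def S_def)
    fix g' d' x
    show "ch g d (Num n) \<in> ends g' d' x \<longleftrightarrow> (g', d', x) \<in> (\<lambda>x. (g, d, x)) ` S n"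
      if "label_ok d' x" using that num[OF \<open>n \<in> _\<close>] by (cases x) (auto simp: S_def)
  qed
  then show "n \<in> {0..9} \<Longrightarrow> card {e \<in> edge_ids. ch g d (Num n) \<in> edge_of e} = 3" .
qed

text \<open>Most vertices are written through the source \<open>g\<close> of the chain that owns
  some of their edges, and two of them through the preceding colour. This avoids inverses of
  generators and of \<open>nxt\<close> in the lists of edges.\<close>

lemma card_incident_blowup:
  assumes g: "g \<in> carrier G" and d: "d \<in> {1..k}"
  shows "card {e \<in> edge_ids. AV (g \<otimes> s d) (nxt k d) 1 \<in> edge_of e} = 3"
    "card {e \<in> edge_ids. AV g d 2 \<in> edge_of e} = 3"
    "card {e \<in> edge_ids. AV (g \<otimes> s d) d 3 \<in> edge_of e} = 3"
    "card {e \<in> edge_ids. AV (g \<otimes> s d) d 4 \<in> edge_of e} = 3"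
    "k \<ge> 2 \<Longrightarrow> card {e \<in> edge_ids. CV (g \<otimes> s d) d 1 \<in> edge_of e} = 3"
    "k \<ge> 3 \<Longrightarrow> card {e \<in> edge_ids. CV g (nxt k d) 2 \<in> edge_of e} = 3"
proof -
  define h where "h = g \<otimes> s d"
  have h: "h \<in> carrier G" unfolding h_def using g d by (rule mult_s_closed)
  have d': "nxt k d \<in> {1..k}" using nxt_simps(1)[OF d] .
  have inj: "h = g' \<otimes> s d \<longleftrightarrow> g' = g" if "g' \<in> carrier G" for g'
    unfolding h_def using mult_s_cancel[OF d g that] by auto
  note d_inj = nxt_inj[OF d]
  have idI: "(g, d, x) \<in> edge_ids \<longleftrightarrow> label_ok d x" "(h, d, x) \<in> edge_ids \<longleftrightarrow> label_ok d x"
    "(h, nxt k d, x) \<in> edge_ids \<longleftrightarrow> label_ok (nxt k d) x" "(g, nxt k d, x) \<in> edge_ids \<longleftrightarrow> label_ok (nxt k d) x" for x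
    using g h d d' unfolding edge_ids_def by simp_all
  show "card {e \<in> edge_ids. AV (g \<otimes> s d) (nxt k d) 1 \<in> edge_of e} = 3" unfolding h_def[symmetric]
  proof (rule card_incidentI[of "{(g, d, EA41), (h, nxt k d, ER 0), (h, nxt k d, EU 0)}"])
    fix g' d' x assume "g' \<in> carrier G" "d' \<in> {1..k}" "label_ok d' x"
    then show "AV h (nxt k d) 1 \<in> ends g' d' x \<longleftrightarrow>
       (g', d', x) \<in> {(g, d, EA41), (h, nxt k d, ER 0), (h, nxt k d, EU 0)}"
      using inj[of g'] d_inj[of d'] by (cases x) auto
  qed (simp_all add: idI)
  show "card {e \<in> edge_ids. AV g d 2 \<in> edge_of e} = 3"
  proof (rule card_incidentI[of "{(g, d, EL 0), (g, d, ER 0), (g, d, EAC)}"])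
    fix g' d' x assume "g' \<in> carrier G" "d' \<in> {1..k}" "label_ok d' x"
    then show "AV g d 2 \<in> ends g' d' x \<longleftrightarrow> (g', d', x) \<in> {(g, d, EL 0), (g, d, ER 0), (g, d, EAC)}"
      by (cases x) auto
  qed (simp_all add: idI)
  show "card {e \<in> edge_ids. AV (g \<otimes> s d) d 3 \<in> edge_of e} = 3" unfolding h_def[symmetric]
  \<comment> \<open>For \<open>k = 1\<close> the third edge is the direct one between the vertices
    1.2 and 1.3, which is owned by the chain leaving \<open>h\<close> rather than by the one
    arriving.\<close>
  proof (rule card_incidentI[of "{(g, d, E9A), (g, d, EA34), if k = 1 then (h, d, EAC) else (g, d, ECA)}"])
    fix g' d' x assume "g' \<in> carrier G" "d' \<in> {1..k}" "label_ok d' x"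
    then show "AV h d 3 \<in> ends g' d' x \<longleftrightarrow>
       (g', d', x) \<in> {(g, d, E9A), (g, d, EA34), if k = 1 then (h, d, EAC) else (g, d, ECA)}"
      using inj[of g'] by (cases x) auto
  next
    have "(if k = 1 then (h, d, EAC) else (g, d, ECA)) \<in> edge_ids"
      unfolding if_split[of "\<lambda>z. z \<in> edge_ids"] idI label_ok.simps by blast
    then show "{(g, d, E9A), (g, d, EA34), if k = 1 then (h, d, EAC) else (g, d, ECA)} \<subseteq> edge_ids"
      unfolding insert_subset idI label_ok.simps by blast
  qed simp
  show "card {e \<in> edge_ids. AV (g \<otimes> s d) d 4 \<in> edge_of e} = 3" unfolding h_def[symmetric]
  proof (rule card_incidentI[of "{(g, d, E6A), (g, d, EA34), (g, d, EA41)}"])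
    fix g' d' x assume "g' \<in> carrier G" "d' \<in> {1..k}" "label_ok d' x"
    then show "AV h d 4 \<in> ends g' d' x \<longleftrightarrow> (g', d', x) \<in> {(g, d, E6A), (g, d, EA34), (g, d, EA41)}"
      using inj[of g'] by (cases x) auto
  qed (simp_all add: idI)
  show "card {e \<in> edge_ids. CV (g \<otimes> s d) d 1 \<in> edge_of e} = 3" if k2: "k \<ge> 2" unfolding h_def[symmetric]
  \<comment> \<open>For \<open>k = 2\<close> the edge between the two vertices \<open>CV\<close> is
    named with colour 1, whichever of its ends is considered.\<close>
  proof (rule card_incidentI[of "{(g, d, ECA), (h, d, EAC), (h, if k = 2 then 1 else d, EC12)}"])
    fix g' d' x assume "g' \<in> carrier G" "d' \<in> {1..k}" "label_ok d' x"
    moreover have "k = 2 \<Longrightarrow> d = 1 \<or> d = 2" using d by auto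
    ultimately show "CV h d 1 \<in> ends g' d' x \<longleftrightarrow>
        (g', d', x) \<in> {(g, d, ECA), (h, d, EAC), (h, if k = 2 then 1 else d, EC12)}"
      using inj[of g'] k2 by (cases x) auto
  next
    have "(h, if k = 2 then 1 else d, EC12) \<in> edge_ids"
      using h k2 d unfolding edge_ids_def by auto
    then show "{(g, d, ECA), (h, d, EAC), (h, if k = 2 then 1 else d, EC12)} \<subseteq> edge_ids"
      using k2 unfolding insert_subset idI label_ok.simps by auto
  qed simp
  show "card {e \<in> edge_ids. CV g (nxt k d) 2 \<in> edge_of e} = 3" if k3: "k \<ge> 3"
  proof (rule card_incidentI[of "{(g, d, EC22), (g, nxt k d, EC22), (g, nxt k d, EC12)}"])
    fix g' d' x assume "g' \<in> carrier G" "d' \<in> {1..k}" "label_ok d' x"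
    then show "CV g (nxt k d) 2 \<in> ends g' d' x \<longleftrightarrow>
        (g', d', x) \<in> {(g, d, EC22), (g, nxt k d, EC22), (g, nxt k d, EC12)}"
      using d_inj[of d'] k3 by (cases x) auto
  next
    show "card {(g, d, EC22), (g, nxt k d, EC22), (g, nxt k d, EC12)} = 3"
      using nxt_simps(5)[OF d] k3 by auto
  qed (use k3 in \<open>simp add: idI\<close>)
qed

lemma cubic_DG: "cubic_graph DG"
proof -
  have "card {e \<in> edge_ids. v \<in> edge_of e} = 3" if "v \<in> verts DG" for v
    using that
  proof (cases v rule: verts_DG_cases)
    case (1 g d)
    have "prv d \<in> {1..k}" using nxt_simps(2)[OF 1(2)] .
    moreover obtain g' where "g' \<in> carrier G" "g = g' \<otimes> s (prv d)"
      using obtain_source[OF 1(1) nxt_simps(2)[OF 1(2)]] .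
    ultimately show ?thesis
      using card_incident_blowup(1)[of g' "prv d"] 1 nxt_simps(3)[OF 1(2)] by simp
  next
    case (2 g d)
    then show ?thesis using card_incident_blowup(2) by simp
  next
    case (3 g d)
    obtain g' where "g' \<in> carrier G" "g = g' \<otimes> s d" using obtain_source[OF 3(1,2)] .
    then show ?thesis using card_incident_blowup(3) 3 by simp
  next
    case (4 g d)
    obtain g' where "g' \<in> carrier G" "g = g' \<otimes> s d" using obtain_source[OF 4(1,2)] .
    then show ?thesis using card_incident_blowup(4) 4 by simp
  next
    case (5 g d)
    obtain g' where "g' \<in> carrier G" "g = g' \<otimes> s d" using obtain_source[OF 5(1,2)] .
    then show ?thesis using card_incident_blowup(5) 5 by simp
  next
    case (6 g d)
    then show ?thesis
      using card_incident_blowup(6)[OF 6(1) nxt_simps(2)[OF 6(2)] 6(3)] nxt_simps(3)[OF 6(2)] by simp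
  qed (use card_incident_chain in simp_all)
  moreover have "{e \<in> edges DG. v \<in> e} = edge_of ` {e \<in> edge_ids. v \<in> edge_of e}" for v unfolding edges_DG by blast
  moreover have "card (edge_of ` {e \<in> edge_ids. v \<in> edge_of e}) = card {e \<in> edge_ids. v \<in> edge_of e}" for v
    by (rule card_image) (rule inj_on_subset[OF inj_on_edge_of], blast)
  ultimately show ?thesis using fin_DG unfolding cubic_graph_def regular_def degree_def by simp
qed

section \<open>The two faces at an edge\<close>

definition roof_step :: "'a \<times> nat \<Rightarrow> 'a \<times> nat" where
  "roof_step = (\<lambda>(g, d). (g \<otimes> s d, nxt k d))"

definition base_step :: "'a \<times> nat \<Rightarrow> 'a \<times> nat" where
  "base_step = (\<lambda>(g, d). (g \<otimes> s d, d))"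

abbreviation roof :: "'a \<Rightarrow> nat \<Rightarrow> 'a face" where
  "roof g d \<equiv> Roof (orb roof_step (g, d))"

abbreviation base :: "'a \<Rightarrow> nat \<Rightarrow> 'a face" where
  "base g d \<equiv> Base (orb base_step (g, d))"

text \<open>Since \<open>Oct h d\<close> covers the far half of superscript \<open>d\<close> and the
  near half of \<open>nxt k d\<close>, edges on the departing side (\<open>ER 0\<close>,
  \<open>EAC\<close>) see the octagon of \<open>prv d\<close> at \<open>g\<close>, and those on the
  arriving side see the octagon of \<open>d\<close> at the target. A rung separates consecutive
  quadrangles of the ladder, with an octagon before the first and the pentagon after the
  last.\<close>

primrec sides :: "'a \<Rightarrow> nat \<Rightarrow> edge_label \<Rightarrow> 'a face set" where
  "sides g d (EU i) = {roof g d, Ladder g d i}"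
| "sides g d (EL i) = {base g d, Ladder g d i}"
| "sides g d (ER i) = {if i = 0 then Oct g (prv d) else Ladder g d (i - 1),
     if i = Suc d then Pent g d else Ladder g d i}"
| "sides g d E01 = {roof g d, Tri g d}"
| "sides g d E02 = {roof g d, Quad g d}"
| "sides g d E03 = {Tri g d, Quad g d}"
| "sides g d E13 = {Tri g d, Hex g d}"
| "sides g d E16 = {roof g d, Hex g d}"
| "sides g d E24 = {roof g d, Pent g d}"
| "sides g d E25 = {Quad g d, Pent g d}"
| "sides g d E35 = {Quad g d, Hex g d}"
| "sides g d E58 = {Pent g d, Hex g d}"
| "sides g d E69 = {Hex g d, Finish g d}"
| "sides g d E78 = {base g d, Pent g d}"
| "sides g d E89 = {base g d, Hex g d}"
| "sides g d E6A = {roof g d, Finish g d}"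
| "sides g d E9A = {base g d, Finish g d}"
| "sides g d EA34 = {Finish g d, Oct (g \<otimes> s d) d}"
| "sides g d EA41 = {roof g d, Oct (g \<otimes> s d) d}"
| "sides g d ECA = {base g d, Oct (g \<otimes> s d) d}"
| "sides g d EAC = {base g d, Oct g (prv d)}"
| "sides g d EC12 = {Oct g d, Oct g (prv d)}"
| "sides g d EC22 = {Oct g d, Centre g}"

definition sides_of :: "'a \<times> nat \<times> edge_label \<Rightarrow> 'a face set" where
  "sides_of = (\<lambda>(g, d, x). sides g d x)"

text \<open>Defined for any name, without reference to a cyclic order. Whether it is a cycle is
  proved separately for each kind of face.\<close>

definition face_graph :: "'a face \<Rightarrow> 'a vertex ugraph" where
  "face_graph f = edge_graph (edge_of ` {e \<in> edge_ids. f \<in> sides_of e})"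

primrec face_ok :: "'a face \<Rightarrow> bool" where
  "face_ok (Ladder g d i) \<longleftrightarrow> g \<in> carrier G \<and> d \<in> {1..k} \<and> i \<le> d"
| "face_ok (Tri g d) \<longleftrightarrow> g \<in> carrier G \<and> d \<in> {1..k}"
| "face_ok (Quad g d) \<longleftrightarrow> g \<in> carrier G \<and> d \<in> {1..k}"
| "face_ok (Pent g d) \<longleftrightarrow> g \<in> carrier G \<and> d \<in> {1..k}"
| "face_ok (Hex g d) \<longleftrightarrow> g \<in> carrier G \<and> d \<in> {1..k}"
| "face_ok (Finish g d) \<longleftrightarrow> g \<in> carrier G \<and> d \<in> {1..k}"
| "face_ok (Oct g d) \<longleftrightarrow> g \<in> carrier G \<and> d \<in> {1..k}"
| "face_ok (Centre g) \<longleftrightarrow> g \<in> carrier G \<and> k \<ge> 3"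
| "face_ok (Roof S) \<longleftrightarrow> S \<in> orb roof_step ` (carrier G \<times> {1..k})"
| "face_ok (Base S) \<longleftrightarrow> S \<in> orb base_step ` (carrier G \<times> {1..k})"

section \<open>Roof and base permutations, and injectivity of the side map\<close>

lemma step_props:
  "finite (carrier G \<times> {1..k})"
  "inj_on roof_step (carrier G \<times> {1..k})" "roof_step ` (carrier G \<times> {1..k}) \<subseteq> carrier G \<times> {1..k}"
  "inj_on base_step (carrier G \<times> {1..k})" "base_step ` (carrier G \<times> {1..k}) \<subseteq> carrier G \<times> {1..k}"
proof -
  show "finite (carrier G \<times> {1..k})" using fin by simp
  show "roof_step ` (carrier G \<times> {1..k}) \<subseteq> carrier G \<times> {1..k}"
    "base_step ` (carrier G \<times> {1..k}) \<subseteq> carrier G \<times> {1..k}"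
    using mult_s_closed nxt_simps(1) unfolding roof_step_def base_step_def by fast+
  show "inj_on roof_step (carrier G \<times> {1..k})"
  proof (rule inj_onI)
    fix x y assume xy: "x \<in> carrier G \<times> {1..k}" "y \<in> carrier G \<times> {1..k}" "roof_step x = roof_step y"
    obtain g d g' d' where eq: "x = (g, d)" "y = (g', d')" by (cases x; cases y)
    then have "d = d'" using xy nxt_inj[of d d'] unfolding roof_step_def by simp
    then show "x = y" using xy eq mult_s_cancel[of d g g'] unfolding roof_step_def by simp
  qed
  show "inj_on base_step (carrier G \<times> {1..k})"
  proof (rule inj_onI)
    fix x y assume xy: "x \<in> carrier G \<times> {1..k}" "y \<in> carrier G \<times> {1..k}" "base_step x = base_step y"
    obtain g d g' d' where eq: "x = (g, d)" "y = (g', d')" by (cases x; cases y)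
    then have "d = d'" using xy(3) unfolding base_step_def by simp
    then show "x = y" using xy eq mult_s_cancel[of d g g'] unfolding base_step_def by simp
  qed
qed

text \<open>Base cycles never change their generator, so equal base faces have equal colours. Roof
  orbits have no such invariant, since they run through all generators.\<close>

lemma snd_base_orb: "y \<in> orb base_step x \<Longrightarrow> snd y = snd x"
proof -
  have "snd ((base_step ^^ n) x) = snd x" for n
    by (induction n) (auto simp: base_step_def split: prod.splits)
  then show "y \<in> orb base_step x \<Longrightarrow> snd y = snd x" unfolding orb_def by auto
qed

text \<open>The values of \<open>prv\<close> are abstracted to \<open>p\<close> and \<open>p'\<close>, since otherwise equations such as
  \<open>d = prv (prv d)\<close> make the simplifier loop.\<close>

lemma sides_inj:
  "label_ok d x \<Longrightarrow> label_ok d' x' \<Longrightarrow> sides g d x = sides g' d' x' \<Longrightarrow>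
   (g \<otimes> s d = g' \<otimes> s d \<longleftrightarrow> g = g') \<Longrightarrow> prv d = p \<Longrightarrow> prv d' = p' \<Longrightarrow> (p = p' \<longleftrightarrow> d = d') \<Longrightarrow> (p = d \<longleftrightarrow> k = 1) \<Longrightarrow>
   (orb base_step (g, d) = orb base_step (g', d') \<Longrightarrow> d = d') \<Longrightarrow> 
   (k \<ge> 3 \<Longrightarrow> p = d' \<Longrightarrow> p' = d \<Longrightarrow> False) \<Longrightarrow> 
   g = g' \<and> d = d' \<and> x = x'"
  by (cases x; cases x'; simp add: doubleton_eq_iff split: if_splits; auto?)

lemma inj_on_sides_of: "inj_on sides_of edge_ids"
proof (rule inj_onI)
  fix e e' assume e: "e \<in> edge_ids" "e' \<in> edge_ids" "sides_of e = sides_of e'"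
  obtain g d x g' d' x' where ee: "e = (g, d, x)" "e' = (g', d', x')" by (metis prod_cases3)
  have dd: "d \<in> {1..k}" "d' \<in> {1..k}" and gg: "g \<in> carrier G" "g' \<in> carrier G"
    and ok: "label_ok d x" "label_ok d' x'" and eq: "sides g d x = sides g' d' x'"
    using e unfolding ee edge_ids_def sides_of_def by blast+
  have 1: "g \<otimes> s d = g' \<otimes> s d \<longleftrightarrow> g = g'" using dd gg by simp
  have 2: "prv d = prv d' \<longleftrightarrow> d = d'" using nxt_simps(3) dd by metis
  have 3: "prv d = d \<longleftrightarrow> k = 1" using nxt_simps(6) dd by metis
  have 4: "orb base_step (g, d) = orb base_step (g', d') \<Longrightarrow> d = d'"
    using snd_base_orb[of "(g, d)" "(g', d')"] orb_self by fastforce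
  \<comment> \<open>This separates the edges \<open>EC12\<close> of two colours, whose pairs of
    octagons would agree if each colour preceded the other.\<close>
  have 5: "k \<ge> 3 \<Longrightarrow> prv d = d' \<Longrightarrow> prv d' = d \<Longrightarrow> False"
    using nxt_nxt nxt_simps(3) dd by metis
  have "g = g' \<and> d = d' \<and> x = x'"
    by (rule sides_inj[OF ok eq 1 refl refl 2 3 4 5])
  then show "e = e'" by (simp add: ee)
qed

lemma sides_of_ok:
  assumes "e \<in> edge_ids"
  shows "sides_of e \<subseteq> Collect face_ok \<and> card (sides_of e) = 2"
proof -
  obtain g d x where e: "e = (g, d, x)" and g: "g \<in> carrier G" and d: "d \<in> {1..k}" and ok: "label_ok d x"
    using assms unfolding edge_ids_def by auto
  have p: "prv d \<in> {1..k}" "prv d = d \<longleftrightarrow> k = 1" using nxt_simps d by auto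
  have gs: "g \<otimes> s d \<in> carrier G" using g d by simp
  have "sides g d x \<subseteq> Collect face_ok" using ok g d p(1) gs
    by (cases x) auto
  moreover have "card (sides g d x) = 2" using ok p(2) by (cases x) auto
  ultimately show ?thesis unfolding e sides_of_def by simp
qed

section \<open>Inner faces\<close>

definition face_cycle :: "'a face \<Rightarrow> 'a vertex list \<Rightarrow> bool" where
  "face_cycle f xs \<longleftrightarrow> distinct xs \<and> length xs \<ge> 3 \<and> cyc xs = face_graph f"

lemma face_cycle_in: "face_cycle f xs \<Longrightarrow> cycle_in DG (face_graph f)"
proof -
  assume f: "face_cycle f xs"
  have "edges (cyc xs) \<subseteq> edges DG"
    using f unfolding face_cycle_def face_graph_def edges_DG by auto
  then show ?thesis using f cycle_in_cyc[OF fin_DG] unfolding face_cycle_def by metis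
qed

lemma face_cycleI:
  assumes xs: "distinct xs" "length xs \<ge> 3"
    and path: "path_edges (xs @ [hd xs]) = edge_of ` S" and S: "S \<subseteq> edge_ids"
    and mem: "\<And>g d x. g \<in> carrier G \<Longrightarrow> d \<in> {1..k} \<Longrightarrow> label_ok d x \<Longrightarrow>
        f \<in> sides g d x \<longleftrightarrow> (g, d, x) \<in> S"
  shows "face_cycle f xs"
proof -
  have "f \<in> sides_of e \<longleftrightarrow> e \<in> S" if "e \<in> edge_ids" for e
    using that mem unfolding sides_of_def edge_ids_def by auto
  then have "{e \<in> edge_ids. f \<in> sides_of e} = S" using S by blast
  moreover have "xs \<noteq> []" using xs by auto
  ultimately show ?thesis
    using xs path cyc_eq_edge_graph[of xs] unfolding face_cycle_def face_graph_def by (simp add: edges_cyc)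
qed

lemma chain_face_cycleI:
  assumes "g \<in> carrier G" "d \<in> {1..k}" "distinct xs" "length xs \<ge> 3"
    and "path_edges (xs @ [hd xs]) = ends g d ` X"
    and "\<And>x. x \<in> X \<Longrightarrow> label_ok d x"
    and "\<And>g' d' x. label_ok d' x \<Longrightarrow> f \<in> sides g' d' x \<longleftrightarrow> g' = g \<and> d' = d \<and> x \<in> X"
  shows "face_cycle f xs"
proof (rule face_cycleI[of _ "(\<lambda>x. (g, d, x)) ` X"])
  show "path_edges (xs @ [hd xs]) = edge_of ` (\<lambda>x. (g, d, x)) ` X"
    using assms(5) unfolding image_image edge_of_def by simp
  show "(\<lambda>x. (g, d, x)) ` X \<subseteq> edge_ids" using assms(1,2,6) unfolding edge_ids_def by auto
  fix g' d' x assume "label_ok d' x"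
  then show "f \<in> sides g' d' x \<longleftrightarrow> (g', d', x) \<in> (\<lambda>x. (g, d, x)) ` X" using assms(7) by auto
qed (use assms in simp_all)

lemma chain_face_cycles:
  assumes g: "g \<in> carrier G" and d: "d \<in> {1..k}"
  shows "i \<le> d \<Longrightarrow> face_cycle (Ladder g d i) [upv g d i, upv g d (Suc i), lov g d (Suc i), lov g d i]"
    "face_cycle (Tri g d) [ch g d (Num 0), ch g d (Num 1), ch g d (Num 3)]"
    "face_cycle (Quad g d) [ch g d (Num 0), ch g d (Num 2), ch g d (Num 5), ch g d (Num 3)]"
    "face_cycle (Pent g d) [ch g d (Num 2), ch g d (Num 4), ch g d (Num 7), ch g d (Num 8), ch g d (Num 5)]"
    "face_cycle (Hex g d) [ch g d (Num 1), ch g d (Num 3), ch g d (Num 5), ch g d (Num 8), ch g d (Num 9), ch g d (Num 6)]"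
    "face_cycle (Finish g d) [ch g d (Num 6), ch g d (Num 9), AV (g \<otimes> s d) d 3, AV (g \<otimes> s d) d 4]"
proof -
  note I = chain_face_cycleI[OF g d]
  show "face_cycle (Ladder g d i) [upv g d i, upv g d (Suc i), lov g d (Suc i), lov g d i]" if i: "i \<le> d"
  proof (rule I[of _ "{EU i, ER (Suc i), EL i, ER i}"])
    fix g' d' x assume "label_ok d' x"
    then show "Ladder g d i \<in> sides g' d' x \<longleftrightarrow> g' = g \<and> d' = d \<and> x \<in> {EU i, ER (Suc i), EL i, ER i}"
      using i by (cases x) auto
  qed (use i in \<open>auto simp: insert_commute\<close>)
  show "face_cycle (Tri g d) [ch g d (Num 0), ch g d (Num 1), ch g d (Num 3)]"
  proof (rule I[of _ "{E01, E13, E03}"])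
    fix g' d' x
    show "Tri g d \<in> sides g' d' x \<longleftrightarrow> g' = g \<and> d' = d \<and> x \<in> {E01, E13, E03}"
      by (cases x) auto
  qed (auto simp: insert_commute)
  show "face_cycle (Quad g d) [ch g d (Num 0), ch g d (Num 2), ch g d (Num 5), ch g d (Num 3)]"
  proof (rule I[of _ "{E02, E25, E35, E03}"])
    fix g' d' x
    show "Quad g d \<in> sides g' d' x \<longleftrightarrow> g' = g \<and> d' = d \<and> x \<in> {E02, E25, E35, E03}"
      by (cases x) auto
  qed (auto simp: insert_commute)
  show "face_cycle (Pent g d) [ch g d (Num 2), ch g d (Num 4), ch g d (Num 7), ch g d (Num 8), ch g d (Num 5)]"
  proof (rule I[of _ "{E24, ER (Suc d), E78, E58, E25}"])
    fix g' d' x assume "label_ok d' x"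
    then show "Pent g d \<in> sides g' d' x \<longleftrightarrow> g' = g \<and> d' = d \<and> x \<in> {E24, ER (Suc d), E78, E58, E25}"
      by (cases x) auto
  qed (auto simp: insert_commute upv_def lov_def)
  show "face_cycle (Hex g d) [ch g d (Num 1), ch g d (Num 3), ch g d (Num 5), ch g d (Num 8), ch g d (Num 9), ch g d (Num 6)]"
  proof (rule I[of _ "{E13, E35, E58, E89, E69, E16}"])
    fix g' d' x
    show "Hex g d \<in> sides g' d' x \<longleftrightarrow> g' = g \<and> d' = d \<and> x \<in> {E13, E35, E58, E89, E69, E16}"
      by (cases x) auto
  qed (auto simp: insert_commute)
  show "face_cycle (Finish g d) [ch g d (Num 6), ch g d (Num 9), AV (g \<otimes> s d) d 3, AV (g \<otimes> s d) d 4]"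
  proof (rule I[of _ "{E69, E9A, EA34, E6A}"])
    fix g' d' x
    show "Finish g d \<in> sides g' d' x \<longleftrightarrow> g' = g \<and> d' = d \<and> x \<in> {E69, E9A, EA34, E6A}"
      by (cases x) auto
  qed (auto simp: insert_commute)
qed

text \<open>The edges of this face are owned by chains at two group elements: the arriving chain at
  \<open>g\<close> and chains leaving \<open>h\<close>. Hence \<open>chain_face_cycleI\<close>,
  which works with one chain, does not apply.\<close>

lemma oct_mem:
  assumes g: "g \<in> carrier G" and d: "d \<in> {1..k}" and h: "h = g \<otimes> s d"
    and g': "g' \<in> carrier G" and d': "d' \<in> {1..k}" and ok: "label_ok d' x"
  shows "k \<ge> 3 \<Longrightarrow> Oct h d \<in> sides g' d' x \<longleftrightarrow> (g', d', x) \<in>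
      {(g, d, ECA), (g, d, EA34), (g, d, EA41), (h, nxt k d, ER 0),
         (h, nxt k d, EAC), (h, nxt k d, EC12), (h, d, EC22), (h, d, EC12)}"
    "k = 2 \<Longrightarrow> Oct h d \<in> sides g' d' x \<longleftrightarrow> (g', d', x) \<in>
      {(g, d, ECA), (g, d, EA34), (g, d, EA41), (h, nxt k d, ER 0), (h, nxt k d, EAC), (h, 1, EC12)}"
    "k = 1 \<Longrightarrow> Oct h d \<in> sides g' d' x \<longleftrightarrow> (g', d', x) \<in>
      {(h, nxt k d, ER 0), (h, nxt k d, EAC), (g, d, EA34), (g, d, EA41)}"
proof -
  have 1: "h = g' \<otimes> s d \<longleftrightarrow> g' = g" unfolding h using mult_s_cancel[OF d g g'] by auto
  have 2: "d = prv d' \<longleftrightarrow> d' = nxt k d" using nxt_simps[OF d] nxt_simps[OF d'] by metis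
  \<comment> \<open>For \<open>k = 2\<close> the merged edge \<open>EC12\<close> belongs to both
    hexagons: its colour 1 is \<open>d\<close> or the successor of \<open>d\<close>.\<close>
  have 3: "k = 2 \<Longrightarrow> d' = 1 \<Longrightarrow> d = 1 \<or> d' = nxt k d" using d unfolding nxt_def by auto
  \<comment> \<open>With \<open>p\<close> and \<open>n\<close> in place of \<open>prv d'\<close> and
    \<open>nxt k d\<close>, all that the case split sees of the cyclic order is the equivalence of
    \<open>d = p\<close> and \<open>d' = n\<close>.\<close>
  have raw3: "prv d' = p \<Longrightarrow> (h = g' \<otimes> s d \<longleftrightarrow> g' = g) \<Longrightarrow> (d = p \<longleftrightarrow> d' = n) \<Longrightarrow> x = EC12 \<longrightarrow> d' \<noteq> p \<Longrightarrow>
      Oct h d \<in> sides g' d' x \<longleftrightarrow> (g', d', x) \<in> {(g, d, ECA), (g, d, EA34), (g, d, EA41), (h, n, ER 0),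
         (h, n, EAC), (h, n, EC12), (h, d, EC22), (h, d, EC12)}" for p n
    by (cases x) auto
  have raw2: "prv d' = p \<Longrightarrow> (h = g' \<otimes> s d \<longleftrightarrow> g' = g) \<Longrightarrow> (d = p \<longleftrightarrow> d' = n) \<Longrightarrow> x \<noteq> EC22 \<Longrightarrow> (x = EC12 \<longrightarrow> d' = 1 \<and> (d = 1 \<or> d' = n)) \<Longrightarrow>
      Oct h d \<in> sides g' d' x \<longleftrightarrow> (g', d', x) \<in> {(g, d, ECA), (g, d, EA34), (g, d, EA41), (h, n, ER 0), (h, n, EAC), (h, 1, EC12)}" for p n
    by (cases x) auto
  have raw1: "prv d' = p \<Longrightarrow> (h = g' \<otimes> s d \<longleftrightarrow> g' = g) \<Longrightarrow> (d = p \<longleftrightarrow> d' = n) \<Longrightarrow> x \<noteq> ECA \<Longrightarrow> x \<noteq> EC12 \<Longrightarrow> x \<noteq> EC22 \<Longrightarrow>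
      Oct h d \<in> sides g' d' x \<longleftrightarrow> (g', d', x) \<in> {(h, n, ER 0), (h, n, EAC), (g, d, EA34), (g, d, EA41)}" for p n
    by (cases x) auto
  have okC: "x = ECA \<Longrightarrow> k \<noteq> 1" "x = EC12 \<Longrightarrow> k \<ge> 3 \<or> k = 2 \<and> d' = 1" "x = EC22 \<Longrightarrow> k \<ge> 3"
    using ok by simp_all
  show "k \<ge> 3 \<Longrightarrow> Oct h d \<in> sides g' d' x \<longleftrightarrow> (g', d', x) \<in>
      {(g, d, ECA), (g, d, EA34), (g, d, EA41), (h, nxt k d, ER 0),
         (h, nxt k d, EAC), (h, nxt k d, EC12), (h, d, EC22), (h, d, EC12)}"
    using nxt_simps(6)[OF d'] by (intro raw3[OF refl 1 2]) auto
  show "k = 2 \<Longrightarrow> Oct h d \<in> sides g' d' x \<longleftrightarrow> (g', d', x) \<in>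
      {(g, d, ECA), (g, d, EA34), (g, d, EA41), (h, nxt k d, ER 0), (h, nxt k d, EAC), (h, 1, EC12)}"
    using okC(2,3) 3 by (intro raw2[OF refl 1 2]) fastforce+
  show "k = 1 \<Longrightarrow> Oct h d \<in> sides g' d' x \<longleftrightarrow> (g', d', x) \<in>
      {(h, nxt k d, ER 0), (h, nxt k d, EAC), (g, d, EA34), (g, d, EA41)}"
    using okC by (intro raw1[OF refl 1 2]) auto
qed

lemma blowup_face_cycles:
  assumes h: "h \<in> carrier G" and d: "d \<in> {1..k}"
  shows "k \<ge> 3 \<Longrightarrow> face_cycle (Oct h d) [CV h d 1, AV h d 3, AV h d 4, AV h (nxt k d) 1, AV h (nxt k d) 2,
             CV h (nxt k d) 1, CV h (nxt k d) 2, CV h d 2]"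
    "k = 2 \<Longrightarrow> face_cycle (Oct h d) [CV h d 1, AV h d 3, AV h d 4, AV h (nxt k d) 1, AV h (nxt k d) 2,
             CV h (nxt k d) 1]"
    "k = 1 \<Longrightarrow> face_cycle (Oct h d) [AV h 1 1, AV h 1 2, AV h 1 3, AV h 1 4]"
proof -
  obtain g where g: "g \<in> carrier G" "h = g \<otimes> s d" using obtain_source[OF h d] .
  note mem = oct_mem[OF g(1) d g(2)]
  have n: "nxt k d \<in> {1..k}" "nxt k d = d \<longleftrightarrow> k = 1" using nxt_simps[OF d] by auto
  have idI: "(g, d, x) \<in> edge_ids \<longleftrightarrow> label_ok d x" "(h, d, x) \<in> edge_ids \<longleftrightarrow> label_ok d x"
    "(h, nxt k d, x) \<in> edge_ids \<longleftrightarrow> label_ok (nxt k d) x" "(h, 1, x) \<in> edge_ids \<longleftrightarrow> label_ok 1 x" for x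
    using g(1) h d n(1) k unfolding edge_ids_def by simp_all
  have eqs: "edge_of (g, d, EA34) = {AV h d 3, AV h d 4}" "edge_of (g, d, EA41) = {AV h d 4, AV h (nxt k d) 1}"
    "edge_of (g, d, ECA) = {CV h d 1, AV h d 3}" "edge_of (h, j, ER 0) = {AV h j 1, AV h j 2}"
    "k \<noteq> 1 \<Longrightarrow> edge_of (h, j, EAC) = {AV h j 2, CV h j 1}" "k = 1 \<Longrightarrow> edge_of (h, j, EAC) = {AV h j 2, AV h j 3}"
    "k = 2 \<Longrightarrow> edge_of (h, 1, EC12) = {CV h 1 1, CV h 2 1}"
    "k \<noteq> 2 \<Longrightarrow> edge_of (h, j, EC12) = {CV h j 1, CV h j 2}"
    "edge_of (h, j, EC22) = {CV h j 2, CV h (nxt k j) 2}" for j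
    unfolding edge_of_def prod.case ends.simps g(2) by (simp_all add: upv_def lov_def)
  show "face_cycle (Oct h d) [CV h d 1, AV h d 3, AV h d 4, AV h (nxt k d) 1, AV h (nxt k d) 2,
             CV h (nxt k d) 1, CV h (nxt k d) 2, CV h d 2]" if k3: "k \<ge> 3"
  proof (rule face_cycleI[of _ "{(g, d, ECA), (g, d, EA34), (g, d, EA41), (h, nxt k d, ER 0),
         (h, nxt k d, EAC), (h, nxt k d, EC12), (h, d, EC22), (h, d, EC12)}"])
    fix g' d' x assume a: "g' \<in> carrier G" "d' \<in> {1..k}" "label_ok d' x"
    show "Oct h d \<in> sides g' d' x \<longleftrightarrow> (g', d', x) \<in>
        {(g, d, ECA), (g, d, EA34), (g, d, EA41), (h, nxt k d, ER 0),
         (h, nxt k d, EAC), (h, nxt k d, EC12), (h, d, EC22), (h, d, EC12)}"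
      by (rule mem(1)[OF a k3])
  next
    have "{CV h (nxt k d) 2, CV h d 2} = {CV h d 2, CV h (nxt k d) (2::nat)}"
      "{CV h d 2, CV h d 1} = {CV h d 1, CV h d (2::nat)}" by blast+
    moreover have k12: "k \<noteq> 1" "k \<noteq> 2" using k3 by auto
    ultimately show "path_edges ([CV h d 1, AV h d 3, AV h d 4, AV h (nxt k d) 1, AV h (nxt k d) 2,
             CV h (nxt k d) 1, CV h (nxt k d) 2, CV h d 2] @ [hd [CV h d 1, AV h d 3, AV h d 4, AV h (nxt k d) 1,
             AV h (nxt k d) 2, CV h (nxt k d) 1, CV h (nxt k d) 2, CV h d 2]])
      = edge_of ` {(g, d, ECA), (g, d, EA34), (g, d, EA41), (h, nxt k d, ER 0),
         (h, nxt k d, EAC), (h, nxt k d, EC12), (h, d, EC22), (h, d, EC12)}"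
      unfolding image_insert eqs(1-4,9) eqs(5)[OF k12(1)] eqs(8)[OF k12(2)] by simp
  next
    show "{(g, d, ECA), (g, d, EA34), (g, d, EA41), (h, nxt k d, ER 0),
         (h, nxt k d, EAC), (h, nxt k d, EC12), (h, d, EC22), (h, d, EC12)} \<subseteq> edge_ids"
      using k3 unfolding insert_subset idI label_ok.simps by simp
  qed (use k3 n in auto)
  show "face_cycle (Oct h d) [CV h d 1, AV h d 3, AV h d 4, AV h (nxt k d) 1, AV h (nxt k d) 2,
             CV h (nxt k d) 1]" if k2: "k = 2"
  proof (rule face_cycleI[of _ "{(g, d, ECA), (g, d, EA34), (g, d, EA41), (h, nxt k d, ER 0),
         (h, nxt k d, EAC), (h, 1, EC12)}"])
    fix g' d' x assume a: "g' \<in> carrier G" "d' \<in> {1..k}" "label_ok d' x"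
    show "Oct h d \<in> sides g' d' x \<longleftrightarrow> (g', d', x) \<in>
        {(g, d, ECA), (g, d, EA34), (g, d, EA41), (h, nxt k d, ER 0), (h, nxt k d, EAC), (h, 1, EC12)}"
      by (rule mem(2)[OF a k2])
  next
    \<comment> \<open>The closing edge of either hexagon is the merged edge, since
      \<open>nxt\<close> exchanges the two colours.\<close>
    have "{CV h (nxt k d) 1, CV h d 1} = {CV h 1 1, CV h 2 (1::nat)}"
      using d k2 unfolding nxt_def by auto
    then show "path_edges ([CV h d 1, AV h d 3, AV h d 4, AV h (nxt k d) 1, AV h (nxt k d) 2, CV h (nxt k d) 1] @
        [hd [CV h d 1, AV h d 3, AV h d 4, AV h (nxt k d) 1, AV h (nxt k d) 2, CV h (nxt k d) 1]])
      = edge_of ` {(g, d, ECA), (g, d, EA34), (g, d, EA41), (h, nxt k d, ER 0), (h, nxt k d, EAC), (h, 1, EC12)}"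
      using k2 eqs(5,7) unfolding image_insert eqs(1-4) by simp
  next
    show "{(g, d, ECA), (g, d, EA34), (g, d, EA41), (h, nxt k d, ER 0), (h, nxt k d, EAC), (h, 1, EC12)} \<subseteq> edge_ids"
      using k2 unfolding insert_subset idI label_ok.simps by simp
  qed (use k2 n in auto)
  show "face_cycle (Oct h d) [AV h 1 1, AV h 1 2, AV h 1 3, AV h 1 4]" if k1: "k = 1"
  proof (rule face_cycleI[of _ "{(h, nxt k d, ER 0), (h, nxt k d, EAC), (g, d, EA34), (g, d, EA41)}"])
    fix g' d' x assume a: "g' \<in> carrier G" "d' \<in> {1..k}" "label_ok d' x"
    show "Oct h d \<in> sides g' d' x \<longleftrightarrow> (g', d', x) \<in>
        {(h, nxt k d, ER 0), (h, nxt k d, EAC), (g, d, EA34), (g, d, EA41)}"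
      by (rule mem(3)[OF a k1])
  next
    have "d = 1" "nxt k d = 1" using d k1 unfolding nxt_def by auto
    then show "path_edges ([AV h 1 1, AV h 1 2, AV h 1 3, AV h 1 4] @ [hd [AV h 1 1, AV h 1 2, AV h 1 3, AV h 1 4]])
      = edge_of ` {(h, nxt k d, ER 0), (h, nxt k d, EAC), (g, d, EA34), (g, d, EA41)}"
      unfolding image_insert eqs(1-4) eqs(6)[OF k1] by simp
  next
    show "{(h, nxt k d, ER 0), (h, nxt k d, EAC), (g, d, EA34), (g, d, EA41)} \<subseteq> edge_ids"
      unfolding insert_subset idI label_ok.simps by simp
  qed (use k1 n in auto)
qed

lemma centre_face_cycle:
  assumes g: "g \<in> carrier G" and k3: "k \<ge> 3"
  shows "face_cycle (Centre g) (map (\<lambda>d. CV g d 2) [1..<k+1])"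
proof (rule face_cycleI[of _ "(\<lambda>d. (g, d, EC22)) ` {1..k}"])
  have "hd (map (\<lambda>d. CV g d 2) [1..<k+1]) = CV g 1 (2::nat)" using k by (simp add: hd_map upt_rec)
  moreover have "path_edges (map (\<lambda>d. CV g d 2) [1..<k+1] @ [CV g 1 2])
     = (\<lambda>d. {CV g d 2, CV g (nxt k d) 2}) ` {1..k}"
  proof -
    have "path_edges (map (\<lambda>d. CV g d 2) [1..<k+1] @ [CV g 1 2])
       = (\<lambda>d. {CV g d 2, CV g (Suc d) 2}) ` {1..<k} \<union> {{CV g k 2, CV g 1 2}}"
      using k by (subst path_edges_append) (simp_all add: path_edges_map_upt del: upt_Suc, simp)
    also have "(\<lambda>d. {CV g d 2, CV g (Suc d) 2}) ` {1..<k} = (\<lambda>d. {CV g d 2, CV g (nxt k d) 2}) ` {1..<k}"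
      by (rule image_cong) (auto simp: nxt_def)
    also have "{1..k} = insert k {1..<k}" using k by auto
    ultimately show ?thesis by (simp add: nxt_def) 
  qed
  ultimately show "path_edges (map (\<lambda>d. CV g d 2) [1..<k + 1] @ [hd (map (\<lambda>d. CV g d 2) [1..<k + 1])])
     = edge_of ` (\<lambda>d. (g, d, EC22)) ` {1..k}"
    unfolding image_image edge_of_def by simp
  show "(\<lambda>d. (g, d, EC22)) ` {1..k} \<subseteq> edge_ids" using g k3 unfolding edge_ids_def by auto
  fix g' d' x assume "g' \<in> carrier G" "d' \<in> {1..k}" "label_ok d' x"
  then show "Centre g \<in> sides g' d' x \<longleftrightarrow> (g', d', x) \<in> (\<lambda>d. (g, d, EC22)) ` {1..k}"
    by (cases x) auto
qed (use k3 in \<open>auto simp: distinct_map inj_on_def\<close>)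

lemma chain_faces_eq:
  assumes g: "g \<in> carrier G" and d: "d \<in> {1..k}"
  shows "chain_faces d g (g \<otimes> s d) = face_graph ` (Ladder g d ` {..d} \<union> {Tri g d, Quad g d, Pent g d, Hex g d, Finish g d})"
proof -
  note c = chain_face_cycles[OF g d, unfolded face_cycle_def, THEN conjunct2, THEN conjunct2]
  have dd: "{..d} = insert 0 (insert d {1..<d})" using d by auto
  have "cyc [ch g d (Up i), ch g d (Up (i+1)), ch g d (Low (i+1)), ch g d (Low i)] = face_graph (Ladder g d i)"
    if "1 \<le> i" "i < d" for i using c(1)[of i] that by (simp add: upv_def lov_def)
  then have "(\<lambda>i. cyc [ch g d (Up i), ch g d (Up (i+1)), ch g d (Low (i+1)), ch g d (Low i)]) ` {1..<d}
    = face_graph ` Ladder g d ` {1..<d}" unfolding image_image by (intro image_cong) auto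
  moreover have "{cyc [ch g d (Up i), ch g d (Up (i+1)), ch g d (Low (i+1)), ch g d (Low i)] | i. 1 \<le> i \<and> i < d}
    = (\<lambda>i. cyc [ch g d (Up i), ch g d (Up (i+1)), ch g d (Low (i+1)), ch g d (Low i)]) ` {1..<d}" by auto
  ultimately have 1: "{cyc [ch g d (Up i), ch g d (Up (i+1)), ch g d (Low (i+1)), ch g d (Low i)] | i. 1 \<le> i \<and> i < d}
    = face_graph ` Ladder g d ` {1..<d}" by simp
  have 2: "cyc [ch g d (Up d), ch g d (Num 4), ch g d (Num 7), ch g d (Low d)] = face_graph (Ladder g d d)"
    using c(1)[of d] d by (simp add: upv_def lov_def)
  \<comment> \<open>The definition lists this quadrangle in the opposite direction, so the two lists
    are compared through their edges.\<close>
  have "cyc [AV g d 1, AV g d 2, ch g d (Low 1), ch g d (Up 1)]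
      = cyc [AV g d 1, ch g d (Up 1), ch g d (Low 1), AV g d 2]"
    by (subst (1 2) cyc_eq_edge_graph) (auto simp: edges_cyc insert_commute)
  then have 3: "cyc [AV g d 1, AV g d 2, ch g d (Low 1), ch g d (Up 1)] = face_graph (Ladder g d 0)"
    using c(1)[of 0] d by (simp add: upv_def lov_def)
  show ?thesis unfolding chain_faces_def Let_def 1 2 3 dd c(2-6) image_Un image_insert by blast
qed

lemma blowup_faces_eq:
  assumes g: "g \<in> carrier G"
  shows "blowup_faces k g = face_graph ` (Oct g ` {1..k} \<union> (if k \<ge> 3 then {Centre g} else {}))"
proof -
  note c = blowup_face_cycles[OF g, unfolded face_cycle_def, THEN conjunct2, THEN conjunct2]
  consider "k \<ge> 3" | "k = 2" "{1..k} = {1, 2}" | "k = 1" "{1..k} = {1}" using k by fastforce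
  then show ?thesis
  proof cases
    case 1
    have "{cyc [CV g d 1, AV g d 3, AV g d 4, AV g (nxt k d) 1, AV g (nxt k d) 2,
             CV g (nxt k d) 1, CV g (nxt k d) 2, CV g d 2] | d. d \<in> {1..k}} = face_graph ` Oct g ` {1..k}"
      unfolding image_image Setcompr_eq_image Collect_mem_eq using c(1)[OF _ 1] by (intro image_cong) auto
    then show ?thesis using 1 centre_face_cycle[OF g 1] unfolding blowup_faces_def face_cycle_def by simp
  next
    case 2
    have "{cyc [CV g d 1, AV g d 3, AV g d 4, AV g (nxt k d) 1, AV g (nxt k d) 2,
             CV g (nxt k d) 1] | d. d \<in> {1,2}} = face_graph ` Oct g ` {1, 2}"
      unfolding image_image Setcompr_eq_image Collect_mem_eq
      by (intro image_cong) (use c(2)[OF _ 2(1)] 2(2) in blast)+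
    then show ?thesis using 2 unfolding blowup_faces_def by simp
  next
    case 3
    have "cyc [AV g 1 1, AV g 1 2, AV g 1 3, AV g 1 4] = face_graph (Oct g 1)"
      using c(3)[of 1] 3 by simp
    then show ?thesis using 3 unfolding blowup_faces_def by simp
  qed
qed

section \<open>Roof and base cycles\<close>

abbreviation "states \<equiv> carrier G \<times> {1..k}"

lemma upper_path_eq:
  "upper_path d g (g \<otimes> s d) = map (upv g d) [0..<Suc (Suc d)] @
     [ch g d (Num 2), ch g d (Num 0), ch g d (Num 1), ch g d (Num 6), AV (g \<otimes> s d) d 4]"
proof -
  have "[0..<Suc (Suc d)] = 0 # [1..<Suc d] @ [Suc d]" by (simp add: upt_conv_Cons)
  then show ?thesis unfolding upper_path_def by (simp add: upv_def)
qed

lemma lower_path_eq: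
  "lower_path d g (g \<otimes> s d) = map (lov g d) [0..<Suc (Suc d)] @
     [ch g d (Num 8), ch g d (Num 9), AV (g \<otimes> s d) d 3]"
proof -
  have "[0..<Suc (Suc d)] = 0 # [1..<Suc d] @ [Suc d]" by (simp add: upt_conv_Cons)
  then show ?thesis unfolding lower_path_def by (simp add: lov_def)
qed

definition roof_block :: "'a \<times> nat \<Rightarrow> 'a vertex list" where
  "roof_block = (\<lambda>(g, d). upper_path d g (g \<otimes> s d))"

definition base_block :: "'a \<times> nat \<Rightarrow> 'a vertex list" where
  "base_block = (\<lambda>(g, d). lower_path d g (g \<otimes> s d) @ (if k = 1 then [] else [CV (g \<otimes> s d) d 1]))"

text \<open>\<open>EA41\<close> is kept apart because it leads from the last vertex of a block to
  the head of the next. It is named by the state being left, so these are the edges of a block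
  together with its exit.\<close>

definition roof_labels :: "nat \<Rightarrow> edge_label set" where
  "roof_labels d = EU ` {..d} \<union> {E24, E02, E01, E16, E6A} \<union> {EA41}"

text \<open>\<open>EAC\<close> is absent: it leads into the next block but is named by the state
  after the step, and it is treated separately. For \<open>k = 1\<close> a block ends before the
  vertex \<open>CV\<close>, hence the condition on \<open>ECA\<close>.\<close>

definition base_labels :: "nat \<Rightarrow> edge_label set" where
  "base_labels d = EL ` {..d} \<union> {E78, E89, E9A} \<union> {x. x = ECA \<and> k \<noteq> 1}"

lemma Roof_in_sides:
  "label_ok d l \<Longrightarrow> Roof S \<in> sides g d l \<longleftrightarrow> l \<in> roof_labels d \<and> S = orb roof_step (g, d)"
  unfolding roof_labels_def by (cases l) auto

lemma Base_in_sides: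
  "label_ok d l \<Longrightarrow> Base S \<in> sides g d l \<longleftrightarrow> l \<in> base_labels d \<union> {EAC} \<and> S = orb base_step (g, d)"
  unfolding base_labels_def by (cases l) auto

lemma label_ok_if:
  "l \<in> roof_labels d \<Longrightarrow> label_ok d l" "l \<in> base_labels d \<union> {EAC} \<Longrightarrow> label_ok d l"
  unfolding roof_labels_def base_labels_def by auto

text \<open>Blocks are disjoint because each vertex carries the colour and the source or target of
  its chain, and either of these determines the state once the colour is known. If source and target
  coincide, the ends of a block still differ in their last superscript, 1 against 4.\<close>

lemma roof_block_props:
  "roof_block y \<noteq> []" "distinct (roof_block y)" "length (roof_block y) \<ge> 3"
  "y \<in> states \<Longrightarrow> z \<in> states \<Longrightarrow> y \<noteq> z \<Longrightarrow> set (roof_block y) \<inter> set (roof_block z) = {}"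
  "path_edges (roof_block (g, d)) = ends g d ` (EU ` {..d} \<union> {E24, E02, E01, E16, E6A})"
  "hd (roof_block (g, d)) = AV g d 1" "last (roof_block (g, d)) = AV (g \<otimes> s d) d 4"
proof -
  obtain g d where y: "y = (g, d)" by fastforce
  show "roof_block y \<noteq> []" "length (roof_block y) \<ge> 3" unfolding roof_block_def y by (simp_all add: upper_path_eq)
  show "distinct (roof_block y)" unfolding roof_block_def y prod.case upper_path_eq
    by (auto simp: distinct_map inj_on_def simp del: upt_Suc)
  show "y \<in> states \<Longrightarrow> z \<in> states \<Longrightarrow> y \<noteq> z \<Longrightarrow> set (roof_block y) \<inter> set (roof_block z) = {}"
  proof -
    obtain g' d' where z: "z = (g', d')" by fastforce
    assume "y \<in> states" "z \<in> states" "y \<noteq> z"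
    then have "\<not> (d = d' \<and> g \<otimes> s d = g' \<otimes> s d')" "\<not> (d = d' \<and> g = g')" unfolding y z by auto
    then show ?thesis unfolding y z roof_block_def prod.case upper_path_def by auto
  qed
next
  have "{0..<Suc d} = {..d}" by auto
  then have u: "path_edges (map (upv g d) [0..<Suc (Suc d)]) = (\<lambda>i. ends g d (EU i)) ` {..d}"
    by (simp only: path_edges_map_upt ends.simps)
  have l: "last (map (upv g d) [0..<Suc (Suc d)]) = ch g d (Num 4)" by (simp add: upv_def)
  have r: "insert {ch g d (Num 4), ch g d (Num 2)}
      (path_edges [ch g d (Num 2), ch g d (Num 0), ch g d (Num 1), ch g d (Num 6), AV (g \<otimes> s d) d 4])
    = ends g d ` {E24, E02, E01, E16, E6A}" by (simp add: insert_commute)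
  have "path_edges (upper_path d g (g \<otimes> s d)) = path_edges (map (upv g d) [0..<Suc (Suc d)]) \<union>
      insert {last (map (upv g d) [0..<Suc (Suc d)]), ch g d (Num 2)}
      (path_edges [ch g d (Num 2), ch g d (Num 0), ch g d (Num 1), ch g d (Num 6), AV (g \<otimes> s d) d 4])"
    unfolding upper_path_eq by (subst path_edges_append) (simp_all del: upt_Suc path_edges.simps)
  then show "path_edges (roof_block (g, d)) = ends g d ` (EU ` {..d} \<union> {E24, E02, E01, E16, E6A})"
    unfolding roof_block_def prod.case image_Un image_image u l r .
  show "hd (roof_block (g, d)) = AV g d 1" "last (roof_block (g, d)) = AV (g \<otimes> s d) d 4"
    unfolding roof_block_def upper_path_def by simp_all
qed

lemma base_block_props:
  "base_block y \<noteq> []" "distinct (base_block y)" "length (base_block y) \<ge> 3"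
  "y \<in> states \<Longrightarrow> z \<in> states \<Longrightarrow> y \<noteq> z \<Longrightarrow> set (base_block y) \<inter> set (base_block z) = {}"
  "path_edges (base_block (g, d)) = ends g d ` base_labels d"
  "hd (base_block (g, d)) = AV g d 2"
  "last (base_block (g, d)) = (if k = 1 then AV (g \<otimes> s d) d 3 else CV (g \<otimes> s d) d 1)"
proof -
  obtain g d where y: "y = (g, d)" by fastforce
  show "base_block y \<noteq> []" "length (base_block y) \<ge> 3" unfolding base_block_def y by (simp_all add: lower_path_eq)
  show "distinct (base_block y)" unfolding base_block_def y prod.case lower_path_eq
    by (auto simp: distinct_map inj_on_def simp del: upt_Suc)
  show "y \<in> states \<Longrightarrow> z \<in> states \<Longrightarrow> y \<noteq> z \<Longrightarrow> set (base_block y) \<inter> set (base_block z) = {}"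
  proof -
    obtain g' d' where z: "z = (g', d')" by fastforce
    assume "y \<in> states" "z \<in> states" "y \<noteq> z"
    then have "\<not> (d = d' \<and> g \<otimes> s d = g' \<otimes> s d')" "\<not> (d = d' \<and> g = g')" unfolding y z by auto
    then show ?thesis unfolding y z base_block_def prod.case lower_path_def by auto
  qed
next
  have 0: "{0..<Suc d} = {..d}" by auto
  have u: "path_edges (map (lov g d) [0..<Suc (Suc d)]) = (\<lambda>i. ends g d (EL i)) ` {..d}"
    using 0 by (simp only: path_edges_map_upt ends.simps)
  have l: "last (map (lov g d) [0..<Suc (Suc d)]) = ch g d (Num 7)" by (simp add: lov_def)
  have r: "insert {ch g d (Num 7), ch g d (Num 8)}
      (path_edges [ch g d (Num 8), ch g d (Num 9), AV (g \<otimes> s d) d 3])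
    = ends g d ` {E78, E89, E9A}" by (simp add: insert_commute)
  have "path_edges (lower_path d g (g \<otimes> s d)) = path_edges (map (lov g d) [0..<Suc (Suc d)]) \<union>
      insert {last (map (lov g d) [0..<Suc (Suc d)]), ch g d (Num 8)}
      (path_edges [ch g d (Num 8), ch g d (Num 9), AV (g \<otimes> s d) d 3])"
    unfolding lower_path_eq by (subst path_edges_append) (simp_all del: upt_Suc path_edges.simps)
  then have p: "path_edges (lower_path d g (g \<otimes> s d)) = ends g d ` (EL ` {..d} \<union> {E78, E89, E9A})"
    unfolding image_Un image_image u l r .
  have "lower_path d g (g \<otimes> s d) \<noteq> []" "last (lower_path d g (g \<otimes> s d)) = AV (g \<otimes> s d) d 3"
    unfolding lower_path_def by simp_all
  then show "path_edges (base_block (g, d)) = ends g d ` base_labels d"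
    unfolding base_block_def base_labels_def prod.case image_Un[of _ _ "{x. x = ECA \<and> k \<noteq> 1}"] p[symmetric]
    by (cases "k = 1") (simp_all add: path_edges_append insert_commute)
  show "hd (base_block (g, d)) = AV g d 2"
    "last (base_block (g, d)) = (if k = 1 then AV (g \<otimes> s d) d 3 else CV (g \<otimes> s d) d 1)"
    unfolding base_block_def lower_path_def by simp_all
qed

lemma orb_eq_iff:
  assumes "inj_on f states" "f ` states \<subseteq> states" "x \<in> states" "y \<in> states"
  shows "orb f x = orb f y \<longleftrightarrow> y \<in> orb f x"
  using orb_eq[OF step_props(1) assms(1-3)] orb_self by metis

text \<open>The side map mentions orbits by name; as orbits partition the states, having the same
  name means lying in the orbit of \<open>x\<close>.\<close>

lemma Roof_face_edges:
  assumes x: "x \<in> states"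
  shows "{e \<in> edge_ids. Roof (orb roof_step x) \<in> sides_of e} =
    {(g, d, l) |g d l. (g, d) \<in> orb roof_step x \<and> l \<in> roof_labels d}" (is "?A = ?B")
proof -
  note iff = orb_eq_iff[OF step_props(2,3) x]
  have sub: "orb roof_step x \<subseteq> states" using orb_subset[OF step_props(3) x] .
  have "(g, d, l) \<in> ?A \<longleftrightarrow> (g, d, l) \<in> ?B" for g d l
  proof (cases "(g, d) \<in> states \<and> label_ok d l")
    case True
    then have "Roof (orb roof_step x) \<in> sides g d l \<longleftrightarrow> (g, d) \<in> orb roof_step x \<and> l \<in> roof_labels d"
      using iff[of "(g, d)"] Roof_in_sides by blast
    then show ?thesis using True unfolding edge_ids_def sides_of_def by simp
  next
    case False
    have "(g, d, l) \<notin> ?A" using False unfolding edge_ids_def by auto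
    moreover have "(g, d, l) \<notin> ?B" using False sub label_ok_if(1)[of l d] by auto
    ultimately show ?thesis by blast
  qed
  then have eq: "e \<in> ?A \<longleftrightarrow> e \<in> ?B" for e by (cases e rule: prod_cases3) (simp only:)
  show ?thesis by (rule Set.set_eqI, rule eq)
qed

lemma Base_face_edges:
  assumes x: "x \<in> states"
  shows "{e \<in> edge_ids. Base (orb base_step x) \<in> sides_of e} =
    {(g, d, l) |g d l. (g, d) \<in> orb base_step x \<and> l \<in> base_labels d \<union> {EAC}}" (is "?A = ?B")
proof -
  note iff = orb_eq_iff[OF step_props(4,5) x]
  have sub: "orb base_step x \<subseteq> states" using orb_subset[OF step_props(5) x] .
  have "(g, d, l) \<in> ?A \<longleftrightarrow> (g, d, l) \<in> ?B" for g d l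
  proof (cases "(g, d) \<in> states \<and> label_ok d l")
    case True
    then have "Base (orb base_step x) \<in> sides g d l \<longleftrightarrow> (g, d) \<in> orb base_step x \<and> l \<in> base_labels d \<union> {EAC}"
      using iff[of "(g, d)"] Base_in_sides by blast
    then show ?thesis using True unfolding edge_ids_def sides_of_def by simp
  next
    case False
    have "(g, d, l) \<notin> ?A" using False unfolding edge_ids_def by auto
    moreover have "(g, d, l) \<notin> ?B" using False sub label_ok_if(2)[of l d] by auto
    ultimately show ?thesis by blast
  qed
  then have eq: "e \<in> ?A \<longleftrightarrow> e \<in> ?B" for e by (cases e rule: prod_cases3) (simp only:)
  show ?thesis by (rule Set.set_eqI, rule eq)
qed

lemma face_cycle_if_edges:
  assumes "distinct xs" "length xs \<ge> 3" "path_edges (xs @ [hd xs]) = edge_of ` {e \<in> edge_ids. f \<in> sides_of e}"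
  shows "face_cycle f xs"
proof -
  have "xs \<noteq> []" using assms(2) by auto
  then show ?thesis using assms cyc_eq_edge_graph[of xs]
    unfolding face_cycle_def face_graph_def by (simp add: edges_cyc)
qed

lemma edge_of_image:
  "edge_of ` {(g, d, l) |g d l. (g, d) \<in> S \<and> l \<in> L d} = (\<Union>(g, d)\<in>S. ends g d ` L d)"
proof -
  have eq: "{(g, d, l) |g d l. (g, d) \<in> S \<and> l \<in> L d} = (\<Union>(g, d)\<in>S. (\<lambda>l. (g, d, l)) ` L d)" by auto
  have "edge_of ` (case y of (g, d) \<Rightarrow> (\<lambda>l. (g, d, l)) ` L d) = (case y of (g, d) \<Rightarrow> ends g d ` L d)" for y
    by (cases y) (simp add: image_image edge_of_def)
  then show ?thesis unfolding eq image_UN by simp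
qed

lemma roof_walk:
  assumes x: "x \<in> states"
  shows "\<exists>xs. face_cycle (Roof (orb roof_step x)) xs \<and>
    traced (walk (\<lambda>n. roof_block ((roof_step ^^ n) x))) = cyc xs"
proof -
  obtain xs where xs: "traced (walk (\<lambda>n. roof_block ((roof_step ^^ n) x))) = cyc xs" "distinct xs"
    "length xs \<ge> length (roof_block x)"
    "path_edges (xs @ [hd xs]) = (\<Union>y\<in>orb roof_step x. path_edges (roof_block y) \<union>
        {{last (roof_block y), hd (roof_block (roof_step y))}})"
    by (rule traced_orbit[where B = roof_block, OF step_props(1-3) x roof_block_props(1,2,4)])
  have "path_edges (roof_block (g, d)) \<union> {{last (roof_block (g, d)), hd (roof_block (roof_step (g, d)))}}
     = ends g d ` roof_labels d" for g d
    unfolding roof_step_def prod.case roof_block_props(5-7) roof_labels_def image_Un[of _ _ "{EA41}"]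
    by simp
  then have "path_edges (roof_block y) \<union> {{last (roof_block y), hd (roof_block (roof_step y))}}
     = (case y of (g, d) \<Rightarrow> ends g d ` roof_labels d)" for y by (cases y) (simp only: prod.case)
  then have "path_edges (xs @ [hd xs]) =
     (\<Union>(g, d)\<in>orb roof_step x. ends g d ` roof_labels d)"
    unfolding xs(4) by (simp only:)
  also have "\<dots> = edge_of ` {e \<in> edge_ids. Roof (orb roof_step x) \<in> sides_of e}"
    unfolding Roof_face_edges[OF x] edge_of_image ..
  finally show ?thesis using face_cycle_if_edges[OF xs(2) order_trans[OF roof_block_props(3) xs(3)]] xs(1) by blast
qed

lemma base_walk:
  assumes x: "x \<in> states"
  shows "\<exists>xs. face_cycle (Base (orb base_step x)) xs \<and>
    traced (walk (\<lambda>n. base_block ((base_step ^^ n) x))) = cyc xs"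
proof -
  obtain xs where xs: "traced (walk (\<lambda>n. base_block ((base_step ^^ n) x))) = cyc xs" "distinct xs"
    "length xs \<ge> length (base_block x)"
    "path_edges (xs @ [hd xs]) = (\<Union>y\<in>orb base_step x. path_edges (base_block y) \<union>
        {{last (base_block y), hd (base_block (base_step y))}})"
    by (rule traced_orbit[where B = base_block, OF step_props(1,4,5) x base_block_props(1,2,4)])
  have "path_edges (xs @ [hd xs]) = (\<Union>y\<in>orb base_step x. path_edges (base_block y)) \<union>
      (\<Union>y\<in>orb base_step x. {{last (base_block y), hd (base_block (base_step y))}})"
    unfolding xs(4) by blast
  also have "(\<Union>y\<in>orb base_step x. path_edges (base_block y)) = (\<Union>(g, d)\<in>orb base_step x. ends g d ` base_labels d)"
    using base_block_props(5) by (intro SUP_cong) auto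
  also have "(\<Union>y\<in>orb base_step x. {{last (base_block y), hd (base_block (base_step y))}})
      = (\<lambda>(g, d). ends g d EAC) ` base_step ` orb base_step x"
  proof -
    have "{last (base_block (g, d)), hd (base_block (base_step (g, d)))}
        = (\<lambda>(g, d). ends g d EAC) (base_step (g, d))" for g d
      unfolding base_step_def prod.case base_block_props(6,7) ends.simps by (simp add: insert_commute)
    then have eq: "{last (base_block y), hd (base_block (base_step y))}
        = (\<lambda>(g, d). ends g d EAC) (base_step y)" for y by (cases y) (simp only:)
    show ?thesis unfolding UNION_singleton_eq_range image_image by (intro image_cong refl eq)
  qed
  \<comment> \<open>The edges between blocks are the edges \<open>EAC\<close> of the states after a
    step. As \<open>base_step\<close> permutes the orbit, they are the edges \<open>EAC\<close> of
    all its states.\<close>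
  also have "base_step ` orb base_step x = orb base_step x" by (rule image_orb[OF step_props(1,4,5) x])
  also have "(\<Union>(g, d)\<in>orb base_step x. ends g d ` base_labels d) \<union> (\<lambda>(g, d). ends g d EAC) ` orb base_step x
     = edge_of ` {(g, d, l) |g d l. (g, d) \<in> orb base_step x \<and> l \<in> base_labels d \<union> {EAC}}"
    unfolding edge_of_image by auto
  also have "{(g, d, l) |g d l. (g, d) \<in> orb base_step x \<and> l \<in> base_labels d \<union> {EAC}}
     = {e \<in> edge_ids. Base (orb base_step x) \<in> sides_of e}" unfolding Base_face_edges[OF x] ..
  finally show ?thesis using face_cycle_if_edges[OF xs(2) order_trans[OF base_block_props(3) xs(3)]] xs(1) by blast
qed

section \<open>Traced cycles as faces, and the group elements they visit\<close>

lemma roof_cycle_eq: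
  assumes g: "g \<in> carrier G"
  shows "roof_cycle G k s g = face_graph (roof g 1)" "\<exists>xs. face_cycle (roof g 1) xs"
proof -
  have x: "(g, 1) \<in> states" using g k by simp
  have "roof_cycle G k s g = traced (walk (\<lambda>n. roof_block ((roof_step ^^ n) (g, 1))))"
    unfolding roof_cycle_def roof_state_def roof_step_def roof_block_def ..
  then show "roof_cycle G k s g = face_graph (roof g 1)" "\<exists>xs. face_cycle (roof g 1) xs"
    using roof_walk[OF x] unfolding face_cycle_def by auto
qed

lemma base_cycle_eq:
  assumes g: "g \<in> carrier G" and d: "d \<in> {1..k}"
  shows "base_cycle G k s d g = face_graph (base g d)" "\<exists>xs. face_cycle (base g d) xs"
proof -
  have x: "(g, d) \<in> states" using g d by simp
  have "(base_step ^^ n) (g, d) = (base_elem G s d g n, d)" for n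
    by (induction n) (simp_all add: base_elem_def base_step_def)
  then have "base_cycle G k s d g = traced (walk (\<lambda>n. base_block ((base_step ^^ n) (g, d))))"
    unfolding base_cycle_def base_block_def Let_def by simp
  then show "base_cycle G k s d g = face_graph (base g d)" "\<exists>xs. face_cycle (base g d) xs"
    using base_walk[OF x] unfolding face_cycle_def by auto
qed

lemma verts_face_graph: "v \<in> verts (face_graph f) \<longleftrightarrow> (\<exists>e\<in>edge_ids. f \<in> sides_of e \<and> v \<in> edge_of e)"
  unfolding face_graph_def edge_graph_def by auto

text \<open>The walk leaves \<open>g\<close> at its start and enters the blow-up of \<open>g\<close>
  via \<open>s k\<close> only when it returns: the predecessor of \<open>(g, 1)\<close> has colour
  \<open>k\<close> and lies in the same orbit. Thus every pick of the procedure removes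
  itself.\<close>

lemma roof_visited_self:
  assumes g: "g \<in> carrier G"
  shows "g \<in> roof_visited G k s g"
proof -
  have x: "(g, 1) \<in> states" using g k by simp
  have kk: "k \<in> {1..k}" using k by simp
  obtain h where h: "h \<in> carrier G" "g = h \<otimes> s k" using obtain_source[OF g kk] .
  have "roof_step (h, k) = (g, 1)" unfolding roof_step_def h(2) nxt_def by simp
  then have "(g, 1) \<in> orb roof_step (h, k)" using step_in_orb[OF orb_self, of roof_step "(h, k)"] by simp
  then have "orb roof_step (g, 1) = orb roof_step (h, k)"
    using orb_eq[OF step_props(1-3)] h(1) kk by blast
  then have "(h, k, EA41) \<in> edge_ids \<and> roof g 1 \<in> sides_of (h, k, EA41) \<and> AV g k 4 \<in> edge_of (h, k, EA41)"
    using h kk unfolding edge_ids_def sides_of_def edge_of_def by simp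
  then show ?thesis using g unfolding roof_visited_def roof_cycle_eq(1)[OF g] verts_face_graph by blast
qed

text \<open>Entering the blow-up of \<open>h\<close> via \<open>s k\<close> means that the next
  state is \<open>(h, 1)\<close>, so the roof walk started at \<open>h\<close> runs through the same
  orbit.\<close>

lemma roof_visited_orb:
  assumes g: "g \<in> carrier G" and h: "h \<in> roof_visited G k s g"
  shows "orb roof_step (h, 1) = orb roof_step (g, 1)"
proof -
  have x: "(g, 1) \<in> states" using g k by simp
  have sub: "orb roof_step (g, 1) \<subseteq> states" using orb_subset[OF step_props(3) x] .
  have "\<exists>e\<in>edge_ids. roof g 1 \<in> sides_of e \<and> AV h k 4 \<in> edge_of e"
    using h unfolding roof_visited_def roof_cycle_eq(1)[OF g] verts_face_graph by blast
  then obtain g' d l where e: "(g', d, l) \<in> edge_ids" "roof g 1 \<in> sides_of (g', d, l)" "AV h k 4 \<in> ends g' d l"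
    unfolding edge_of_def by auto
  then have "label_ok d l" "g' \<in> carrier G" "d \<in> {1..k}" "roof g 1 \<in> sides g' d l"
    unfolding edge_ids_def sides_of_def by simp_all
  then have l: "l \<in> roof_labels d" and orb: "orb roof_step (g, 1) = orb roof_step (g', d)"
    using Roof_in_sides by blast+
  \<comment> \<open>Among the roof labels only \<open>E6A\<close> and \<open>EA41\<close> contain a
    vertex whose last superscript is 4, and it lies at the target of the chain.\<close>
  have "d = k \<and> h = g' \<otimes> s k" using l e(3) unfolding roof_labels_def by auto
  then have "roof_step (g', d) = (h, 1)" unfolding roof_step_def nxt_def by simp
  then have "(h, 1) \<in> orb roof_step (g, 1)"
    unfolding orb using step_in_orb[OF orb_self, of roof_step "(g', d)"] by simp
  then show ?thesis by (rule orb_eq[OF step_props(1-3) x])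
qed

lemma base_visited_self:
  assumes g: "g \<in> carrier G" and d: "d \<in> {1..k}"
  shows "g \<in> base_visited G k s d g"
proof -
  have "(g, d, EL 0) \<in> edge_ids \<and> base g d \<in> sides_of (g, d, EL 0) \<and> AV g d 2 \<in> edge_of (g, d, EL 0)"
    using g d unfolding edge_ids_def sides_of_def edge_of_def by simp
  then have "AV g d 2 \<in> verts (face_graph (base g d))" unfolding verts_face_graph by blast
  moreover have "AV g d 2 \<in> verts (blowup k g)"
  proof -
    consider "k \<ge> 3" | "k = 2" "d = 1" | "k = 2" "d = 2" | "k = 1" "d = 1" using d by fastforce
    then show ?thesis using d unfolding blowup_def by cases auto
  qed
  ultimately show ?thesis using g unfolding base_visited_def base_cycle_eq(1)[OF g d] by blast
qed

text \<open>A base cycle meets a blow-up only at the source or the target of one of its own steps,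
  and both of these states are in the orbit. The colour of the step is fixed by
  \<open>snd_base_orb\<close>.\<close>

lemma base_visited_orb:
  assumes g: "g \<in> carrier G" and d: "d \<in> {1..k}" and h: "h \<in> base_visited G k s d g"
  shows "orb base_step (h, d) = orb base_step (g, d)"
proof -
  have x: "(g, d) \<in> states" using g d by simp
  obtain v where v: "v \<in> verts (blowup k h)" "v \<in> verts (face_graph (base g d))"
    using h unfolding base_visited_def base_cycle_eq(1)[OF g d] by blast
  have v': "(\<exists>i j. v = AV h i j) \<or> (\<exists>i j. v = CV h i j)"
    using v(1) unfolding blowup_def by (auto split: if_splits)
  obtain g' d' l where e: "(g', d', l) \<in> edge_ids" "base g d \<in> sides_of (g', d', l)" "v \<in> ends g' d' l"
    using v(2) unfolding verts_face_graph edge_of_def by auto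
  then have "label_ok d' l" "g' \<in> carrier G" "d' \<in> {1..k}" "base g d \<in> sides g' d' l"
    unfolding edge_ids_def sides_of_def by simp_all
  then have l: "l \<in> base_labels d' \<union> {EAC}" and orb: "orb base_step (g, d) = orb base_step (g', d')"
    using Base_in_sides by blast+
  have d': "d' = d" using snd_base_orb[of "(g', d')" "(g, d)"] orb by simp
  have "h = g' \<or> h = g' \<otimes> s d"
    using l e(3) v' unfolding base_labels_def d' by (auto split: if_splits)
  moreover have "base_step (g', d) = (g' \<otimes> s d, d)" unfolding base_step_def by simp
  then have "(g' \<otimes> s d, d) \<in> orb base_step (g', d)"
    using step_in_orb[OF orb_self, of base_step "(g', d)"] by simp
  ultimately have "(h, d) \<in> orb base_step (g, d)" unfolding orb[unfolded d'] by auto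
  then show ?thesis by (rule orb_eq[OF step_props(1,4,5) x])
qed

text \<open>The colour grows by one in each step until it wraps from \<open>k\<close> to 1. So walks
  that start with the generator \<open>s 1\<close> already reach every roof orbit.\<close>

lemma roof_orb_hits_one:
  "g \<in> carrier G \<Longrightarrow> d \<in> {1..k} \<Longrightarrow> \<exists>h\<in>carrier G. orb roof_step (h, 1) = orb roof_step (g, d)"
proof (induction "k - d" arbitrary: g d)
  case 0
  then have "roof_step (g, d) = (g \<otimes> s d, 1)" unfolding roof_step_def nxt_def by simp
  then have "(g \<otimes> s d, 1) \<in> orb roof_step (g, d)"
    using step_in_orb[OF orb_self, of roof_step "(g, d)"] by simp
  then have "orb roof_step (g \<otimes> s d, 1) = orb roof_step (g, d)"
    using 0 by (intro orb_eq[OF step_props(1-3)]) auto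
  then show ?case using mult_s_closed[OF 0(2,3)] by blast
next
  case (Suc m)
  then have dk: "d < k" "Suc d \<in> {1..k}" by auto
  have st: "roof_step (g, d) = (g \<otimes> s d, Suc d)" unfolding roof_step_def nxt_def using dk by simp
  have "\<exists>h\<in>carrier G. orb roof_step (h, 1) = orb roof_step (g \<otimes> s d, Suc d)"
    using Suc.hyps(2) Suc.prems dk by (intro Suc.hyps(1)) auto
  moreover have "orb roof_step (g \<otimes> s d, Suc d) = orb roof_step (g, d)"
    using step_in_orb[OF orb_self, of roof_step "(g, d)"] Suc.prems unfolding st
    by (intro orb_eq[OF step_props(1-3)]) auto
  ultimately show ?case by simp
qed

section \<open>The three families of cycles as families of faces\<close>

lemma roof_cycles_eq:
  assumes "selector (carrier G) chr"
  shows "roof_cycles G k s chr = face_graph ` {f. (\<exists>S. f = Roof S) \<and> face_ok f}"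
proof -
  let ?T = "carrier G - roof_visited G k s \<one>"
  have "sweep chr (roof_cycle G k s) (roof_visited G k s) ?T = roof_cycle G k s ` ?T"
  proof (rule sweep_eq_image)
    show "finite ?T" using fin by simp
    show "chr T' \<in> T'" if "T' \<subseteq> ?T" "T' \<noteq> {}" for T' using that assms unfolding selector_def by blast
    show "x \<in> roof_visited G k s x" if "x \<in> ?T" for x using that roof_visited_self by blast
    show "roof_cycle G k s y = roof_cycle G k s x"
      if "x \<in> ?T" "y \<in> ?T" "y \<in> roof_visited G k s x" for x y
      using that roof_visited_orb[of x y] by (simp add: roof_cycle_eq(1))
  qed
  \<comment> \<open>Elements visited by the cycle of the identity are missing from the sweep, but
    their roof cycle is that of the identity, which is inserted separately.\<close>
  moreover have "roof_cycle G k s y = roof_cycle G k s \<one>" if "y \<in> roof_visited G k s \<one>" "y \<in> carrier G" for y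
    using that roof_visited_orb[of \<one> y] by (simp add: roof_cycle_eq(1))
  ultimately have "roof_cycles G k s chr = roof_cycle G k s ` carrier G"
    unfolding roof_cycles_def by auto
  also have "\<dots> = (\<lambda>g. face_graph (roof g 1)) ` carrier G"
    by (intro image_cong refl roof_cycle_eq(1))
  also have "\<dots> = face_graph ` (\<lambda>g. roof g 1) ` carrier G" unfolding image_image ..
  also have "(\<lambda>g. roof g 1) ` carrier G = {f. (\<exists>S. f = Roof S) \<and> face_ok f}"
  proof
    show "(\<lambda>g. roof g 1) ` carrier G \<subseteq> {f. (\<exists>S. f = Roof S) \<and> face_ok f}" using k by auto
    show "{f. (\<exists>S. f = Roof S) \<and> face_ok f} \<subseteq> (\<lambda>g. roof g 1) ` carrier G"
    proof
      fix f assume "f \<in> {f. (\<exists>S. f = Roof S) \<and> face_ok f}"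
      then obtain g d where gd: "g \<in> carrier G" "d \<in> {1..k}" "f = roof g d" by auto
      obtain h where h: "h \<in> carrier G" "orb roof_step (h, 1) = orb roof_step (g, d)"
        using roof_orb_hits_one[OF gd(1,2)] by blast
      then show "f \<in> (\<lambda>g. roof g 1) ` carrier G" unfolding gd(3) h(2)[symmetric] using h(1) by blast
    qed
  qed
  finally show ?thesis .
qed

lemma base_cycles_eq:
  assumes "\<And>d. d \<in> {1..k} \<Longrightarrow> selector (carrier G) (chb d)"
  shows "base_cycles G k s chb = face_graph ` {f. (\<exists>S. f = Base S) \<and> face_ok f}"
proof -
  have "sweep (chb d) (base_cycle G k s d) (base_visited G k s d) (carrier G)
      = face_graph ` (\<lambda>g. base g d) ` carrier G" if d: "d \<in> {1..k}" for d
  proof -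
    have "sweep (chb d) (base_cycle G k s d) (base_visited G k s d) (carrier G)
        = base_cycle G k s d ` carrier G"
    proof (rule sweep_eq_image)
      show "finite (carrier G)" using fin .
      show "chb d T' \<in> T'" if "T' \<subseteq> carrier G" "T' \<noteq> {}" for T'
        using that assms[OF d] unfolding selector_def by blast
      show "x \<in> base_visited G k s d x" if "x \<in> carrier G" for x using that base_visited_self d by blast
      show "base_cycle G k s d y = base_cycle G k s d x"
        if "x \<in> carrier G" "y \<in> carrier G" "y \<in> base_visited G k s d x" for x y
        using base_visited_orb[OF that(1) d that(3)] base_cycle_eq(1)[OF that(1) d] base_cycle_eq(1)[OF that(2) d]
        by simp
    qed
    also have "\<dots> = (\<lambda>g. face_graph (base g d)) ` carrier G"
      by (intro image_cong refl base_cycle_eq(1) d)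
    finally show ?thesis unfolding image_image .
  qed
  then have "base_cycles G k s chb = face_graph ` (\<Union>d\<in>{1..k}. (\<lambda>g. base g d) ` carrier G)"
    unfolding base_cycles_def image_UN by (intro SUP_cong refl)
  also have "(\<Union>d\<in>{1..k}. (\<lambda>g. base g d) ` carrier G) = {f. (\<exists>S. f = Base S) \<and> face_ok f}"
  proof
    show "(\<Union>d\<in>{1..k}. (\<lambda>g. base g d) ` carrier G) \<subseteq> {f. (\<exists>S. f = Base S) \<and> face_ok f}" by auto
    show "{f. (\<exists>S. f = Base S) \<and> face_ok f} \<subseteq> (\<Union>d\<in>{1..k}. (\<lambda>g. base g d) ` carrier G)"
    proof
      fix f assume "f \<in> {f. (\<exists>S. f = Base S) \<and> face_ok f}"
      then obtain g d where "g \<in> carrier G" "d \<in> {1..k}" "f = base g d" by auto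
      then show "f \<in> (\<Union>d\<in>{1..k}. (\<lambda>g. base g d) ` carrier G)" by blast
    qed
  qed
  finally show ?thesis .
qed

lemma inner_faces_eq:
  "inner_faces G k s = face_graph ` {f. (\<nexists>S. f = Roof S \<or> f = Base S) \<and> face_ok f}"
proof -
  have "inner_faces G k s = (\<Union>d\<in>{1..k}. \<Union>g\<in>carrier G. chain_faces d g (g \<otimes> s d)) \<union>
      (\<Union>g\<in>carrier G. blowup_faces k g)"
    unfolding inner_faces_def Union_cayley_edges ..
  also have "(\<Union>d\<in>{1..k}. \<Union>g\<in>carrier G. chain_faces d g (g \<otimes> s d)) = (\<Union>d\<in>{1..k}. \<Union>g\<in>carrier G.
      face_graph ` (Ladder g d ` {..d} \<union> {Tri g d, Quad g d, Pent g d, Hex g d, Finish g d}))"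
    by (intro SUP_cong refl chain_faces_eq)
  also have "(\<Union>g\<in>carrier G. blowup_faces k g)
     = (\<Union>g\<in>carrier G. face_graph ` (Oct g ` {1..k} \<union> (if k \<ge> 3 then {Centre g} else {})))"
    by (intro SUP_cong refl blowup_faces_eq)
  finally have "inner_faces G k s = face_graph ` ((\<Union>d\<in>{1..k}. \<Union>g\<in>carrier G.
        Ladder g d ` {..d} \<union> {Tri g d, Quad g d, Pent g d, Hex g d, Finish g d}) \<union>
      (\<Union>g\<in>carrier G. Oct g ` {1..k} \<union> (if k \<ge> 3 then {Centre g} else {})))" (is "_ = _ ` ?F")
    unfolding image_Un image_UN .
  also have "?F = {f. (\<nexists>S. f = Roof S \<or> f = Base S) \<and> face_ok f}"
  proof (rule Set.set_eqI)
    fix f show "f \<in> ?F \<longleftrightarrow> f \<in> {f. (\<nexists>S. f = Roof S \<or> f = Base S) \<and> face_ok f}"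
      by (cases f) (auto simp: image_iff)
  qed
  finally show ?thesis .
qed

lemma face_ok_cycle: "face_ok f \<Longrightarrow> \<exists>xs. face_cycle f xs"
proof (cases f)
  case (Oct g d)
  assume "face_ok f"
  then have gd: "g \<in> carrier G" "d \<in> {1..k}" unfolding Oct by simp_all
  consider "k \<ge> 3" | "k = 2" | "k = 1" using k by linarith
  then show ?thesis unfolding Oct using blowup_face_cycles[OF gd] by cases blast+
next
  case (Centre g)
  assume "face_ok f"
  then show ?thesis unfolding Centre using centre_face_cycle by auto
next
  case (Roof S)
  assume "face_ok f"
  then show ?thesis unfolding Roof using roof_walk by auto
next
  case (Base S)
  assume "face_ok f"
  then show ?thesis unfolding Base using base_walk by auto
qed (auto intro!: exI chain_face_cycles)

lemma induces_polyhedral_map_DG: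
  assumes "selector (carrier G) chr" "\<And>d. d \<in> {1..k} \<Longrightarrow> selector (carrier G) (chb d)"
  shows "induces_polyhedral_map DG
    (inner_faces G k s \<union> roof_cycles G k s chr \<union> base_cycles G k s chb)"
proof -
  have base: "base_cycles G k s chb = face_graph ` {f. (\<exists>S. f = Base S) \<and> face_ok f}"
    by (rule base_cycles_eq) (rule assms(2))
  have "inner_faces G k s \<union> roof_cycles G k s chr \<union> base_cycles G k s chb = face_graph ` Collect face_ok"
    unfolding inner_faces_eq roof_cycles_eq[OF assms(1)] base image_Un[symmetric]
    by (rule arg_cong[where f = "(`) face_graph"]) blast
  moreover have "induces_polyhedral_map DG (face_graph ` Collect face_ok)"
  proof (rule induces_polyhedral_map_if_sides[OF cubic_DG edges_DG inj_on_edge_of])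
    show "cycle_in DG (face_graph f)" if "f \<in> Collect face_ok" for f
      using that face_ok_cycle face_cycle_in by blast
    \<comment> \<open>True by construction, since faces were defined from the side map.\<close>
    show "edges (face_graph f) = edge_of ` {e \<in> edge_ids. f \<in> sides_of e}" for f unfolding face_graph_def by simp
  qed (use sides_of_ok inj_on_sides_of in blast)+
  ultimately show ?thesis by simp
qed

end

theorem theorem5p2:
  fixes G :: "('a, 'b) monoid_scheme" and k :: nat and s :: "nat \<Rightarrow> 'a"
    and chr :: "'a set \<Rightarrow> 'a" and chb :: "nat \<Rightarrow> 'a set \<Rightarrow> 'a"
  assumes "group G" and "finite (carrier G)"
    and "k \<ge> 1" and "inj_on s {1..k}" and "s ` {1..k} \<subseteq> carrier G"
    and "generate G (s ` {1..k}) = carrier G"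
    and "selector (carrier G) chr" and "\<And>d. d \<in> {1..k} \<Longrightarrow> selector (carrier G) (chb d)"
  defines "\<Z> \<equiv> inner_faces G k s \<union> roof_cycles G k s chr \<union> base_cycles G k s chb"
  shows "cycle_double_cover (D_graph G k s) \<Z> \<and> induces_polyhedral_map (D_graph G k s) \<Z>"
proof -
  interpret group G by fact
  interpret cayley_blowup G k s by unfold_locales (use assms in auto)
  have "induces_polyhedral_map (D_graph G k s) \<Z>"
    unfolding \<Z>_def by (rule induces_polyhedral_map_DG[OF assms(7,8)])
  then show ?thesis unfolding induces_polyhedral_map_def by blast
qed

end
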